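(* Let $\mathcal H=(V,E)$ be a connected hypergraph with a fixed ribbon structure, base node $b_0$ and base edge $b_0b_1$ on $\mathrm{Bip}\,\mathcal H$. Run the (ht:$E$, cut:$V$) Bernardi process on a hypertree $\mathbf f$ on $E$ and let $T$ be the resulting spanning tree. Then running the (ht:$V$, cut:$E$) Bernardi process on the hypertree $\mathbf f_V(T)$ on $V$, with base node $b_0$, base edge $b_0b_1^-$, and the reversed ribbon structure, also results in $T$.
   Context: $\mathcal H=(V,E)$: $V$ finite set, $E$ finite multiset of nonempty subsets of $V$; $\mathrm{Bip}\,\mathcal H$ has color classes $V$ (violet) and $E$ (emerald), $v$ joined to $e$ iff $v\in e$; connected means $\mathrm{Bip}\,\mathcal H$ connected. A ribbon structure assigns to each node $x$ a cyclic permutation of its incident edges; $xy^+$ (resp. $xy^-$) is the edge following (resp. preceding) $xy$ at $x$; subgraphs inherit restricted orders ($xy^+_G$ in subgraph $G$). The reversed ribbon structure inverts every cyclic permutation; $b_0b_1^-$ refers to the original structure. A hypertree on $E$ is $\mathbf f:E\to\mathbb Z_{\ge0}$ such that some spanning tree $T$ has $d_T(e)=\mathbf f(e)+1$ for all $e\in E$; symmetrically on $V$; $\mathbf f_V(T)(v)=d_T(v)-1$. Bernardi processes with hypertree $\mathbf f$ on $X\in\{E,V\}$, base node $b_0$, base edge $b_0b_1$ (for the given ribbon structure); current graph $G$ initially $\mathrm{Bip}\,\mathcal H$; outcome = final current graph. (ht:$X$, cut:$V$): if $b_0\in V$ start with current edge $b_0b_1$; if $b_0\in E$ start with $b_1b_0^+$,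 $b_0b_1$ counting as traversed from $b_0$. With current edge $ve$ ($v\in V$): if $\mathbf f$ is a hypertree on $X$ in $G-ve$, remove $ve$ and make $ve^+_G$ current; otherwise traverse $ve$ from $v$ and $ew:=ev^+_G$ from $e$, and make $we^+_G$ current. (ht:$X$, cut:$E$): if $b_0\in E$ start with $b_0b_1$; if $b_0\in V$ start with $b_1b_0^+$, $b_0b_1$ counting as traversed from $b_0$. With current edge $ev$ ($e\in E$): if $\mathbf f$ is a hypertree on $X$ in $G-ev$, remove $ev$ and make $ev^+_G$ current; otherwise traverse $ev$ from $e$ and $vd:=ve^+_G$ from $v$, and make $dv^+_G$ current. Each process stops right before an edge would be traversed a second time from the same endpoint. *)

theory Defs
  imports "HOL-Combinatorics.Orbits" "HOL-Library.Multiset" "HOL-Library.While_Combinator"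
begin

section \<open>Graphs, trees and hypertrees\<close>

text \<open>Graphs are simple and undirected: a set \<open>N\<close> of nodes and a set \<open>G\<close> of two-element subsets
  of \<open>N\<close>. All subgraphs that occur contain every node, so they are given by their edge sets.\<close>

definition incident_edges :: "'n set set \<Rightarrow> 'n \<Rightarrow> 'n set set" where
  "incident_edges G x = {\<epsilon> \<in> G. x \<in> \<epsilon>}"

definition degree :: "'n set set \<Rightarrow> 'n \<Rightarrow> nat" where
  "degree G x = card (incident_edges G x)"

definition connected_graph :: "'n set \<Rightarrow> 'n set set \<Rightarrow> bool" where
  "connected_graph N G \<longleftrightarrow> (\<forall>x\<in>N. \<forall>y\<in>N. (x, y) \<in> {(a, b). {a, b} \<in> G}\<^sup>*)"

definition is_cycle :: "'n set set \<Rightarrow> 'n list \<Rightarrow> bool" where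
  "is_cycle G xs \<longleftrightarrow> length xs \<ge> 3 \<and> distinct xs \<and>
     (\<forall>i < length xs. {xs ! i, xs ! (Suc i mod length xs)} \<in> G)"

definition spanning_tree :: "'n set \<Rightarrow> 'n set set \<Rightarrow> 'n set set \<Rightarrow> bool" where
  "spanning_tree N G T \<longleftrightarrow> T \<subseteq> G \<and> connected_graph N T \<and> (\<nexists>xs. is_cycle T xs)"

text \<open>A hypertree on the color class \<open>X\<close> is a function on \<open>X\<close>; here it is given by a function on
  all nodes whose values outside \<open>X\<close> play no role.\<close>

definition hypertree_on :: "'n set \<Rightarrow> 'n set \<Rightarrow> 'n set set \<Rightarrow> ('n \<Rightarrow> nat) \<Rightarrow> bool" where
  "hypertree_on N X G f \<longleftrightarrow>
     (\<exists>T. spanning_tree N G T \<and> (\<forall>x\<in>X. degree T x = f x + 1))"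

text \<open>In a spanning tree of a graph with at least two nodes all degrees are positive, so the
  subtraction is not truncated.\<close>

definition tree_vector :: "'n set set \<Rightarrow> 'n \<Rightarrow> nat" where
  "tree_vector T = (\<lambda>x. degree T x - 1)"


section \<open>Hypergraphs\<close>

text \<open>The multiplicity of a hyperedge is expressed by emerald nodes \<open>(A, i)\<close>, one for each of the
  \<open>count E A\<close> copies of the set \<open>A\<close>.\<close>

type_synonym 'v node = "'v + 'v set \<times> nat"

definition hypergraph :: "'v set \<Rightarrow> 'v set multiset \<Rightarrow> bool" where
  "hypergraph V E \<longleftrightarrow> finite V \<and> (\<forall>A \<in># E. A \<noteq> {} \<and> A \<subseteq> V)"

definition violet :: "'v set \<Rightarrow> 'v node set" where
  "violet V = Inl ` V"

definition emerald :: "'v set multiset \<Rightarrow> 'v node set" where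
  "emerald E = {Inr (A, i) | A i. i < count E A}"

definition bip_nodes :: "'v set \<Rightarrow> 'v set multiset \<Rightarrow> 'v node set" where
  "bip_nodes V E = violet V \<union> emerald E"

definition bip_edges :: "'v set \<Rightarrow> 'v set multiset \<Rightarrow> 'v node set set" where
  "bip_edges V E = {{Inl v, Inr (A, i)} | v A i. v \<in> V \<and> i < count E A \<and> v \<in> A}"

definition connected_hypergraph :: "'v set \<Rightarrow> 'v set multiset \<Rightarrow> bool" where
  "connected_hypergraph V E \<longleftrightarrow>
     hypergraph V E \<and> connected_graph (bip_nodes V E) (bip_edges V E)"


section \<open>Ribbon structures\<close>

definition ribbon_structure ::
  "'n set \<Rightarrow> 'n set set \<Rightarrow> ('n \<Rightarrow> 'n set \<Rightarrow> 'n set) \<Rightarrow> bool" where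
  "ribbon_structure N G \<rho> \<longleftrightarrow>
     (\<forall>x\<in>N. \<rho> x permutes incident_edges G x \<and>
        (incident_edges G x \<noteq> {} \<longrightarrow> cyclic_on (\<rho> x) (incident_edges G x)))"

definition reversed :: "('n \<Rightarrow> 'n set \<Rightarrow> 'n set) \<Rightarrow> 'n \<Rightarrow> 'n set \<Rightarrow> 'n set" where
  "reversed \<rho> = (\<lambda>x. inv (\<rho> x))"

definition opposite :: "'n \<Rightarrow> 'n set \<Rightarrow> 'n" where
  "opposite x \<epsilon> = (THE y. \<epsilon> = {x, y})"

text \<open>\<open>next_edge \<rho> G x \<epsilon>\<close> is the edge following \<open>\<epsilon>\<close> at \<open>x\<close> in the order that the subgraph \<open>G\<close>
  inherits: edges outside \<open>G\<close> are skipped. The edge \<open>xy\<^sup>+\<close> of \<open>G\<close> joins \<open>x\<close> to \<open>next_nbr \<rho> G x y\<close>.\<close>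

definition next_edge :: "('n \<Rightarrow> 'n set \<Rightarrow> 'n set) \<Rightarrow> 'n set set \<Rightarrow> 'n \<Rightarrow> 'n set \<Rightarrow> 'n set" where
  "next_edge \<rho> G x \<epsilon> = (\<rho> x ^^ (LEAST k. 0 < k \<and> (\<rho> x ^^ k) \<epsilon> \<in> G)) \<epsilon>"

definition next_nbr :: "('n \<Rightarrow> 'n set \<Rightarrow> 'n set) \<Rightarrow> 'n set set \<Rightarrow> 'n \<Rightarrow> 'n \<Rightarrow> 'n" where
  "next_nbr \<rho> G x y = opposite x (next_edge \<rho> G x {x, y})"


section \<open>Bernardi processes\<close>

text \<open>In a state \<open>(G, y, x, \<tau>)\<close> the current graph is \<open>G\<close>, the current edge is \<open>{y, x}\<close> with \<open>y\<close> in
  the cut color class \<open>Y\<close>, and \<open>(a, b) \<in> \<tau>\<close> means that the edge \<open>{a, b}\<close> has been traversed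
  from \<open>a\<close>.\<close>

type_synonym 'n bernardi_state = "'n set set \<times> 'n \<times> 'n \<times> ('n \<times> 'n) set"

fun bernardi_init ::
  "'n set \<Rightarrow> ('n \<Rightarrow> 'n set \<Rightarrow> 'n set) \<Rightarrow> 'n \<Rightarrow> 'n \<Rightarrow> 'n set set \<Rightarrow> 'n bernardi_state" where
  "bernardi_init Y \<rho> b0 b1 G =
     (if b0 \<in> Y then (G, b0, b1, {})
      else (G, b1, next_nbr \<rho> G b1 b0, {(b0, b1)}))"

fun bernardi_step ::
  "'n set \<Rightarrow> 'n set \<Rightarrow> ('n \<Rightarrow> 'n set \<Rightarrow> 'n set) \<Rightarrow> ('n \<Rightarrow> nat) \<Rightarrow> 'n bernardi_state \<Rightarrow> 'n bernardi_state"
where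
  "bernardi_step N X \<rho> f (G, y, x, \<tau>) =
     (if hypertree_on N X (G - {{y, x}}) f
      then (G - {{y, x}}, y, next_nbr \<rho> G y x, \<tau>)
      else let w = next_nbr \<rho> G x y
           in (G, w, next_nbr \<rho> G w x, insert (x, w) (insert (y, x) \<tau>)))"

text \<open>The process halts when one of the two traversals of the next step would repeat an earlier one.
  Halting after the first of the two leaves the current graph unchanged, so both cases have the
  same outcome.\<close>

fun bernardi_halted ::
  "'n set \<Rightarrow> 'n set \<Rightarrow> ('n \<Rightarrow> 'n set \<Rightarrow> 'n set) \<Rightarrow> ('n \<Rightarrow> nat) \<Rightarrow> 'n bernardi_state \<Rightarrow> bool" where
  "bernardi_halted N X \<rho> f (G, y, x, \<tau>) \<longleftrightarrow>
     \<not> hypertree_on N X (G - {{y, x}}) f \<and> ((y, x) \<in> \<tau> \<or> (x, next_nbr \<rho> G x y) \<in> \<tau>)"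

text \<open>The outcome of the (ht:\<open>X\<close>, cut:\<open>Y\<close>) process on the graph \<open>(N, G)\<close> with base edge \<open>b0 b1\<close> at
  the base node \<open>b0\<close>; it would be \<open>None\<close> if the process did not stop.\<close>

definition bernardi_outcome ::
  "'n set \<Rightarrow> 'n set set \<Rightarrow> 'n set \<Rightarrow> 'n set \<Rightarrow> ('n \<Rightarrow> 'n set \<Rightarrow> 'n set) \<Rightarrow> 'n \<Rightarrow> 'n \<Rightarrow> ('n \<Rightarrow> nat)
     \<Rightarrow> 'n set set option" where
  "bernardi_outcome N G X Y \<rho> b0 b1 f =
     map_option fst
       (while_option (\<lambda>s. \<not> bernardi_halted N X \<rho> f s) (bernardi_step N X \<rho> f)
          (bernardi_init Y \<rho> b0 b1 G))"

end

theory Submission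
  imports Defs
begin

text \<open>A flag is a node with an incident edge. The tour of a spanning tree \<open>T\<close> goes across the
  edge of the current flag if it lies in \<open>T\<close> and then turns to the next edge at the node reached;
  it is a single cycle through all flags. Call \<open>T\<close> a Jaeger tree for the cut class \<open>Y\<close> if the tour
  meets every non-tree edge first at its end in \<open>Y\<close>.

  Among the trees that realize a given hypertree, the one whose tour is lexicographically extreme
  (at \<open>Y\<close> skip an edge as early as possible, at the other class \<open>X\<close> keep one) is a Jaeger tree,
  since an edge first met in \<open>X\<close> could be exchanged for an edge of its fundamental cycle. The
  Bernardi process on a hypertree that is realized by a Jaeger tree follows the tour of this tree,
  because a counting argument shows that it never removes a tree edge. Finally, the tour in the
  reversed ribbon structure from \<open>b\<^sub>0b\<^sub>1\<^sup>-\<close> passes the flags of non-tree edges in the opposite order,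
  so \<open>T\<close> is also a Jaeger tree for the reversed structure with the color classes exchanged.\<close>

section \<open>Spanning trees\<close>

abbreviation adj :: "'n set set \<Rightarrow> ('n \<times> 'n) set" where
  "adj G \<equiv> {(a, b). {a, b} \<in> G}"

lemma adj_rtrancl_sym: "(a, b) \<in> (adj G)\<^sup>* \<Longrightarrow> (b, a) \<in> (adj G)\<^sup>*"
  by (rule symD[OF sym_rtrancl]) (auto simp: sym_def insert_commute)

lemma connected_graph_mono:
  assumes "connected_graph N F" "F \<subseteq> G"
  shows "connected_graph N G"
proof -
  have "(adj F)\<^sup>* \<subseteq> (adj G)\<^sup>*" by (rule rtrancl_mono) (use assms(2) in auto)
  then show ?thesis using assms(1) unfolding connected_graph_def by blast
qed

text \<open>It suffices to find a detour for each single edge. This serves both for deleting an edge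
  and for exchanging tree edges.\<close>

lemma connected_graph_replace:
  assumes "connected_graph N G" "\<And>a b. {a, b} \<in> G \<Longrightarrow> (a, b) \<in> (adj F)\<^sup>*"
  shows "connected_graph N F"
proof -
  have "(adj G)\<^sup>* \<subseteq> (adj F)\<^sup>*"
    by (rule rtrancl_subset_rtrancl) (use assms(2) in auto)
  then show ?thesis using assms(1) unfolding connected_graph_def by blast
qed

lemma connected_graph_remove_edge:
  assumes "connected_graph N G" "(a, b) \<in> (adj (G - {{a, b}}))\<^sup>*"
  shows "connected_graph N (G - {{a, b}})"
  using assms(1)
proof (rule connected_graph_replace)
  fix c d assume cd: "{c, d} \<in> G"
  show "(c, d) \<in> (adj (G - {{a, b}}))\<^sup>*"
  proof (cases "{c, d} = {a, b}")
    case True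
    then have "c = a \<and> d = b \<or> c = b \<and> d = a" by (auto simp: doubleton_eq_iff)
    then show ?thesis using assms(2) adj_rtrancl_sym by metis
  next
    case False
    with cd show ?thesis by (intro r_into_rtrancl) auto
  qed
qed

text \<open>When a new node already occurs on the path, the path is cut back to it. The distinct
  list is what \<open>is_cycle\<close> asks for.\<close>

lemma adj_rtrancl_path:
  assumes "(a, b) \<in> (adj F)\<^sup>*"
  shows "\<exists>xs. xs \<noteq> [] \<and> hd xs = a \<and> last xs = b \<and> distinct xs
           \<and> successively (\<lambda>u v. {u, v} \<in> F) xs"
  using assms
proof (induction rule: rtrancl_induct)
  case base
  show ?case by (rule exI[of _ "[a]"]) auto
next
  case (step b c)
  then obtain xs where xs: "xs \<noteq> []" "hd xs = a" "last xs = b" "distinct xs"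
    "successively (\<lambda>u v. {u, v} \<in> F) xs" by blast
  show ?case
  proof (cases "c \<in> set xs")
    case True
    then obtain ys zs where "xs = ys @ c # zs" by (meson split_list)
    with xs show ?thesis
      by (intro exI[of _ "ys @ [c]"]) (auto simp: hd_append successively_append_iff)
  next
    case False
    with xs step.hyps(2) show ?thesis
      by (intro exI[of _ "xs @ [c]"]) (auto simp: successively_append_iff)
  qed
qed

section \<open>Edge counts and cuts in finite graphs\<close>

locale finite_graph =
  fixes N :: "'n set" and G :: "'n set set"
  assumes finite_nodes: "finite N"
    and edges: "\<epsilon> \<in> G \<Longrightarrow> \<exists>a\<in>N. \<exists>b\<in>N. a \<noteq> b \<and> \<epsilon> = {a, b}"
begin

lemma finite_edges: "finite G"
proof (rule finite_subset)
  show "G \<subseteq> Pow N" using edges by fastforce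
qed (simp add: finite_nodes)

lemma subgraph: "F \<subseteq> G \<Longrightarrow> finite_graph N F"
  by unfold_locales (use finite_nodes edges in auto)

lemma edge_nodes: "{a, b} \<in> G \<Longrightarrow> a \<in> N \<and> b \<in> N"
  using edges by (metis insert_iff singletonD)

lemma edge_neq: "{a, b} \<in> G \<Longrightarrow> a \<noteq> b"
  using edges by fastforce

lemma crossing_edge:
  assumes "connected_graph N G" "a \<in> B" "a \<in> N" "c \<in> N" "c \<notin> B"
  shows "\<exists>u w. u \<in> B \<and> w \<notin> B \<and> {u, w} \<in> G"
proof (rule ccontr)
  assume *: "\<not> ?thesis"
  have "(a, c) \<in> (adj G)\<^sup>*" using assms unfolding connected_graph_def by blast
  then have "c \<in> B" by (induction rule: rtrancl_induct) (use * assms in auto)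
  with assms show False by simp
qed

text \<open>Take an edge from \<open>u\<close> in \<open>B\<close> to a node outside
  \<open>B\<close>. It no longer touches \<open>B - {u}\<close>, so dropping \<open>u\<close> loses
  at least one edge, and induction applies. The bound is used for trees and again for the two sides
  of a cut.\<close>

lemma card_le_touching_edges:
  assumes "connected_graph N G" "B \<subseteq> N" "c \<in> N" "c \<notin> B"
  shows "card B \<le> card {\<epsilon> \<in> G. \<epsilon> \<inter> B \<noteq> {}}"
proof -
  have "finite B" using assms finite_nodes finite_subset by blast
  then show ?thesis using assms(2,4)
  proof (induction "card B" arbitrary: B)
    case 0
    then show ?case by simp
  next
    case (Suc n)
    from Suc.hyps(2) obtain a where "a \<in> B" by fastforce
    then obtain u w where uw: "u \<in> B" "w \<notin> B" "{u, w} \<in> G"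
      using crossing_edge[OF assms(1)] Suc.prems assms(3) by blast
    let ?B = "B - {u}"
    have "card ?B \<le> card {\<epsilon> \<in> G. \<epsilon> \<inter> ?B \<noteq> {}}"
      by (rule Suc.hyps(1)) (use Suc uw in auto)
    moreover have "card (insert {u, w} {\<epsilon> \<in> G. \<epsilon> \<inter> ?B \<noteq> {}})
        = Suc (card {\<epsilon> \<in> G. \<epsilon> \<inter> ?B \<noteq> {}})"
      using finite_edges uw by (subst card_insert_disjoint) auto
    moreover have "card (insert {u, w} {\<epsilon> \<in> G. \<epsilon> \<inter> ?B \<noteq> {}}) \<le> card {\<epsilon> \<in> G. \<epsilon> \<inter> B \<noteq> {}}"
      by (rule card_mono) (use finite_edges uw in auto)
    moreover have "card B = Suc (card ?B)"
      using uw Suc.prems by (metis card_Suc_Diff1)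
    ultimately show ?case by linarith
  qed
qed

lemma card_nodes_le:
  assumes "connected_graph N G"
  shows "card N \<le> card G + 1"
proof (cases "N = {}")
  case False
  then obtain r where r: "r \<in> N" by blast
  have "card (N - {r}) \<le> card {\<epsilon> \<in> G. \<epsilon> \<inter> (N - {r}) \<noteq> {}}"
    by (rule card_le_touching_edges[OF assms _ r]) auto
  also have "\<dots> \<le> card G" by (rule card_mono) (use finite_edges in auto)
  finally show ?thesis using r finite_nodes by (simp add: card_Diff_singleton)
qed simp

text \<open>A tree is grown from \<open>r\<close>: each crossing edge brings exactly one new
  node.\<close>

lemma ex_connected_subset:
  assumes "connected_graph N G" "r \<in> N" "n < card N"
  shows "\<exists>B F. B \<subseteq> N \<and> F \<subseteq> G \<and> r \<in> B \<and> card B = Suc n \<and> card F = n \<and> \<Union>F \<subseteq> B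
           \<and> (\<forall>b\<in>B. (r, b) \<in> (adj F)\<^sup>*)"
  using assms(3)
proof (induction n)
  case 0
  show ?case by (intro exI[of _ "{r}"] exI[of _ "{}"]) (use assms in auto)
next
  case (Suc n)
  then obtain B F where BF: "B \<subseteq> N" "F \<subseteq> G" "r \<in> B" "card B = Suc n" "card F = n" "\<Union>F \<subseteq> B"
    "\<forall>b\<in>B. (r, b) \<in> (adj F)\<^sup>*" by force
  have "\<not> N \<subseteq> B"
    using BF Suc.prems by (metis less_irrefl_nat subset_antisym)
  then obtain c where "c \<in> N" "c \<notin> B" by blast
  from crossing_edge[OF assms(1) BF(3) assms(2) this]
  obtain u w where uw: "u \<in> B" "w \<notin> B" "{u, w} \<in> G" by blast
  have fin: "finite B" "finite F"
    using BF finite_nodes finite_edges finite_subset by blast+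
  have mono: "(adj F)\<^sup>* \<subseteq> (adj (insert {u, w} F))\<^sup>*" by (rule rtrancl_mono) auto
  have "(r, w) \<in> (adj (insert {u, w} F))\<^sup>*"
    by (rule rtrancl_into_rtrancl[of _ u]) (use BF uw mono in auto)
  moreover have "{u, w} \<notin> F" using BF(6) uw by blast
  ultimately show ?case
    by (intro exI[of _ "insert w B"] exI[of _ "insert {u, w} F"])
      (use BF uw mono edge_nodes[OF uw(3)] fin in auto)
qed

text \<open>The grown tree \<open>F\<close> with \<open>card N - 1\<close> edges reaches all nodes.
  An edge of \<open>G\<close> outside \<open>F\<close> would close a path of \<open>F\<close> to a
  cycle, so \<open>F\<close> is all of \<open>G\<close>.\<close>

lemma card_edges_le_if_acyclic:
  assumes "connected_graph N G" "\<nexists>xs. is_cycle G xs" "N \<noteq> {}"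
  shows "card G + 1 \<le> card N"
proof -
  obtain r where r: "r \<in> N" using assms by blast
  have "card N - 1 < card N" using r finite_nodes by (metis card_gt_0_iff diff_less empty_iff zero_less_one)
  from ex_connected_subset[OF assms(1) r this]
  obtain B F where BF: "B \<subseteq> N" "F \<subseteq> G" "card B = Suc (card N - 1)" "card F = card N - 1"
    "\<forall>b\<in>B. (r, b) \<in> (adj F)\<^sup>*" by blast
  have "card B = card N" using BF(3) \<open>card N - 1 < card N\<close> by linarith
  then have B: "B = N" using BF(1) finite_nodes by (simp add: card_subset_eq)
  have "G \<subseteq> F"
  proof (rule ccontr)
    assume "\<not> G \<subseteq> F"
    then obtain a b where ab: "{a, b} \<in> G" "{a, b} \<notin> F" using edges by blast
    then have "a \<in> N" "b \<in> N" using edge_nodes by auto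
    then have "(a, r) \<in> (adj F)\<^sup>*" "(r, b) \<in> (adj F)\<^sup>*"
      using BF(5) B adj_rtrancl_sym[of r a F] by auto
    then have "(a, b) \<in> (adj F)\<^sup>*" by (rule rtrancl_trans)
    from adj_rtrancl_path[OF this]
    obtain xs where xs: "xs \<noteq> []" "hd xs = a" "last xs = b" "distinct xs"
      "successively (\<lambda>u v. {u, v} \<in> F) xs" by blast
    \<comment> \<open>A path with one node would make the edge a loop, and a path with two nodes
      would put it into \<open>F\<close>.\<close>
    have "length xs \<noteq> 1"
      using xs edge_neq[OF ab(1)] by (auto simp: length_Suc_conv)
    moreover have "length xs \<noteq> 2"
      using xs ab by (auto simp: length_Suc_conv numeral_2_eq_2)
    moreover have "length xs \<noteq> 0" using xs by auto
    ultimately have len: "length xs \<ge> 3" by linarith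
    have "{xs ! i, xs ! (Suc i mod length xs)} \<in> G" if "i < length xs" for i
    proof (cases "Suc i < length xs")
      case True
      with xs(5) BF(2) show ?thesis by (auto simp: successively_conv_nth)
    next
      case False
      with that have "Suc i = length xs" by linarith
      moreover from this have "xs ! i = b" using xs by (metis diff_Suc_1 last_conv_nth)
      ultimately show ?thesis using xs ab by (simp add: hd_conv_nth insert_commute)
    qed
    with len xs have "is_cycle G xs" unfolding is_cycle_def by blast
    with assms show False by blast
  qed
  then have "card G \<le> card F" using BF finite_edges by (metis card_mono finite_subset)
  with BF \<open>card N - 1 < card N\<close> show ?thesis by linarith
qed

lemma not_connected_remove:
  assumes "card G + 1 = card N" "\<epsilon> \<in> G"
  shows "\<not> connected_graph N (G - {\<epsilon>})"
proof
  assume *: "connected_graph N (G - {\<epsilon>})"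
  interpret F: finite_graph N "G - {\<epsilon>}" by (rule subgraph) auto
  have "Suc (card (G - {\<epsilon>})) = card G" using finite_edges assms by (metis card_Suc_Diff1)
  with F.card_nodes_le[OF *] assms show False by linarith
qed

text \<open>The rest of a cycle joins the ends of its closing edge. Deleting that edge would keep
  the graph connected with too few edges.\<close>

lemma acyclic_if_card:
  assumes "connected_graph N G" "card G + 1 = card N"
  shows "\<not> is_cycle G xs"
proof
  assume "is_cycle G xs"
  then have xs: "length xs \<ge> 3" "distinct xs"
    "\<And>i. i < length xs \<Longrightarrow> {xs ! i, xs ! (Suc i mod length xs)} \<in> G"
    unfolding is_cycle_def by auto
  let ?n = "length xs - 1"
  let ?\<epsilon> = "{xs ! 0, xs ! ?n}"
  have "Suc ?n = length xs" using xs(1) by linarith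
  then have n: "Suc ?n mod length xs = 0" by simp
  have "?n < length xs" using xs by linarith
  from xs(3)[OF this] have \<epsilon>: "?\<epsilon> \<in> G" unfolding n by (simp add: insert_commute)
  have "(xs ! 0, xs ! i) \<in> (adj (G - {?\<epsilon>}))\<^sup>*" if "i \<le> ?n" for i
    using that
  proof (induction i)
    case (Suc i)
    have "{xs ! i, xs ! Suc i} \<in> G" using xs(3)[of i] Suc.prems by simp
    moreover have "{xs ! i, xs ! Suc i} \<noteq> ?\<epsilon>"
    proof -
      \<comment> \<open>If both equalities held, the list would have only two entries.\<close>
      have "xs ! i \<noteq> xs ! 0 \<or> xs ! Suc i \<noteq> xs ! ?n"
        using nth_eq_iff_index_eq[OF xs(2), of i 0] nth_eq_iff_index_eq[OF xs(2), of "Suc i" ?n]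
          xs(1) Suc.prems by linarith
      moreover have "xs ! Suc i \<noteq> xs ! 0"
        using nth_eq_iff_index_eq[OF xs(2), of "Suc i" 0] xs(1) Suc.prems by linarith
      ultimately show ?thesis by (metis doubleton_eq_iff)
    qed
    ultimately have "(xs ! i, xs ! Suc i) \<in> adj (G - {?\<epsilon>})" by simp
    with Suc show ?case by (meson Suc_leD rtrancl.rtrancl_into_rtrancl)
  qed simp
  then have "connected_graph N (G - {?\<epsilon>})"
    by (intro connected_graph_remove_edge assms) simp
  with not_connected_remove[OF assms(2) \<epsilon>] show False by blast
qed

text \<open>From here on trees are handled by their number of edges instead of by cycles.\<close>

lemma spanning_tree_iff:
  assumes "N \<noteq> {}"
  shows "spanning_tree N G T \<longleftrightarrow> T \<subseteq> G \<and> connected_graph N T \<and> card T + 1 = card N"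
proof (cases "T \<subseteq> G")
  case True
  then interpret T: finite_graph N T by (rule subgraph)
  show ?thesis
    unfolding spanning_tree_def
    using T.card_nodes_le T.card_edges_le_if_acyclic T.acyclic_if_card assms True
    by (metis order_antisym)
qed (simp add: spanning_tree_def)

text \<open>\<open>B\<close> is the component of \<open>b\<close> after the edge is deleted.\<close>

lemma tree_cut:
  assumes "connected_graph N G" "card G + 1 = card N" "{a, b} \<in> G"
  obtains B where "B \<subseteq> N" "b \<in> B" "a \<notin> B"
    "\<forall>u w. {u, w} \<in> G \<longrightarrow> {u, w} \<noteq> {a, b} \<longrightarrow> u \<in> B \<longrightarrow> w \<in> B"
proof
  let ?G = "G - {{a, b}}"
  let ?B = "{c. (b, c) \<in> (adj ?G)\<^sup>*}"
  have B: "c \<in> N" if "(b, c) \<in> (adj ?G)\<^sup>*" for c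
    using that by (induction rule: rtrancl_induct) (use edge_nodes assms in auto)
  then show "?B \<subseteq> N" by auto
  show "b \<in> ?B" by simp
  show "a \<notin> ?B"
    using connected_graph_remove_edge[OF assms(1), of a b] not_connected_remove[OF assms(2,3)]
      adj_rtrancl_sym by (metis mem_Collect_eq)
  show "\<forall>u w. {u, w} \<in> G \<longrightarrow> {u, w} \<noteq> {a, b} \<longrightarrow> u \<in> ?B \<longrightarrow> w \<in> ?B"
    by (auto intro: rtrancl_into_rtrancl)
qed

end

section \<open>Tours of spanning trees\<close>

lemma inj_on_funpow_cancel:
  assumes "inj_on f A" "f ` A \<subseteq> A" "s \<in> A" "(f ^^ i) s = (f ^^ (i + n)) s"
  shows "(f ^^ n) s = s"
  using assms(4)
proof (induction i)
  case (Suc i)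
  have "(f ^^ k) s \<in> A" for k by (induction k) (use assms in auto)
  with Suc show ?case using inj_onD[OF assms(1)] by simp
qed simp

lemma inj_on_funpow_returns:
  assumes "inj_on f A" "f ` A \<subseteq> A" "finite A" "s \<in> A"
  shows "\<exists>n>0. (f ^^ n) s = s"
proof -
  have A: "(f ^^ k) s \<in> A" for k by (induction k) (use assms in auto)
  then have "finite (range (\<lambda>k. (f ^^ k) s))" using assms(3) by (meson finite_subset image_subsetI)
  then have "\<not> inj (\<lambda>k. (f ^^ k) s)" using finite_imageD infinite_UNIV_nat by blast
  then obtain i j where "i < j" "(f ^^ i) s = (f ^^ j) s"
    unfolding inj_def by (metis linorder_neqE_nat)
  then show ?thesis
    using inj_on_funpow_cancel[OF assms(1,2,4), of i "j - i"] by (intro exI[of _ "j - i"]) auto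
qed

text \<open>Up to the least period the iterates of \<open>s\<close> are distinct, and reduction
  modulo the period shows that they exhaust the orbit. So the period is
  \<open>card A\<close>.\<close>

lemma funpow_single_cycle:
  assumes "inj_on f A" "f ` A \<subseteq> A" "finite A" "s \<in> A" "A \<subseteq> range (\<lambda>k. (f ^^ k) s)"
  shows "bij_betw (\<lambda>k. (f ^^ k) s) {..<card A} A" and "(f ^^ card A) s = s"
proof -
  let ?P = "\<lambda>n. 0 < n \<and> (f ^^ n) s = s"
  define n where "n = (LEAST n. ?P n)"
  have n: "0 < n" "(f ^^ n) s = s" and least: "\<And>m. ?P m \<Longrightarrow> n \<le> m"
    using LeastI_ex[OF inj_on_funpow_returns[OF assms(1-4)]] Least_le[of ?P]
    unfolding n_def by auto
  have inj: "inj_on (\<lambda>k. (f ^^ k) s) {..<n}"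
  proof (rule linorder_inj_onI)
    fix i j assume ij: "i < j" "i \<in> {..<n}" "j \<in> {..<n}"
    show "(f ^^ i) s \<noteq> (f ^^ j) s"
    proof
      assume "(f ^^ i) s = (f ^^ j) s"
      then have "(f ^^ (j - i)) s = s"
        using inj_on_funpow_cancel[OF assms(1,2,4), of i "j - i"] ij by simp
      then show False using least[of "j - i"] ij by auto
    qed
  qed auto
  have "(f ^^ k) s \<in> (\<lambda>k. (f ^^ k) s) ` {..<n}" for k
    using n funpow_mod_eq[OF n(2), of k] by (intro image_eqI[of _ _ "k mod n"]) auto
  then have "A \<subseteq> (\<lambda>k. (f ^^ k) s) ` {..<n}" using assms(5) by blast
  moreover have "(f ^^ k) s \<in> A" for k by (induction k) (use assms in auto)
  ultimately have im: "(\<lambda>k. (f ^^ k) s) ` {..<n} = A" by auto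
  then have "card A = n" using card_image[OF inj] by simp
  with inj im n show "bij_betw (\<lambda>k. (f ^^ k) s) {..<card A} A" "(f ^^ card A) s = s"
    unfolding bij_betw_def by auto
qed

section \<open>Flags and the closed tour around a tree\<close>

lemma opposite_doubleton [simp]: "opposite a {a, b} = b" "opposite b {a, b} = a"
  unfolding opposite_def by (auto simp: doubleton_eq_iff)

text \<open>\<open>X\<close> is the class that carries the hypertree and \<open>Y\<close> the class
  at which edges are cut. Keeping them abstract allows the roles to be exchanged later.\<close>

locale bipartite_ribbon =
  fixes N X Y :: "'n set" and G :: "'n set set" and \<rho> :: "'n \<Rightarrow> 'n set \<Rightarrow> 'n set"
  assumes finite_N: "finite N" and N_eq: "N = X \<union> Y" and disjoint: "X \<inter> Y = {}"
    and bipartite: "\<epsilon> \<in> G \<Longrightarrow> \<exists>x\<in>X. \<exists>y\<in>Y. \<epsilon> = {x, y}"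
    and ribbon: "ribbon_structure N G \<rho>"
begin

sublocale finite_graph N G
proof
  fix \<epsilon> assume "\<epsilon> \<in> G"
  from bipartite[OF this] show "\<exists>a\<in>N. \<exists>b\<in>N. a \<noteq> b \<and> \<epsilon> = {a, b}"
    using disjoint N_eq by (metis IntI UnI1 UnI2 empty_iff)
qed (rule finite_N)

definition flags :: "('n \<times> 'n set) set" where
  "flags = {(x, \<epsilon>). \<epsilon> \<in> G \<and> x \<in> \<epsilon>}"

fun across :: "'n set set \<Rightarrow> 'n \<times> 'n set \<Rightarrow> 'n \<times> 'n set" where
  "across T (x, \<epsilon>) = (if \<epsilon> \<in> T then (opposite x \<epsilon>, \<epsilon>) else (x, \<epsilon>))"

fun turn :: "'n \<times> 'n set \<Rightarrow> 'n \<times> 'n set" where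
  "turn (x, \<epsilon>) = (x, \<rho> x \<epsilon>)"

definition tour_step :: "'n set set \<Rightarrow> 'n \<times> 'n set \<Rightarrow> 'n \<times> 'n set" where
  "tour_step T g = turn (across T g)"

lemma finite_flags: "finite flags"
  by (rule finite_subset[of _ "N \<times> G"])
    (use edges finite_N finite_edges in \<open>fastforce simp: flags_def\<close>)+

lemma flagsE:
  assumes "g \<in> flags"
  obtains x y where "g = (x, {x, y})" "{x, y} \<in> G" "x \<in> N" "y \<in> N" "x \<noteq> y"
proof -
  obtain x \<epsilon> where "g = (x, \<epsilon>)" "\<epsilon> \<in> G" "x \<in> \<epsilon>" using assms by (auto simp: flags_def)
  moreover from edges[OF this(2)] obtain a b where "a \<in> N" "b \<in> N" "a \<noteq> b" "\<epsilon> = {a, b}" by blast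
  ultimately show ?thesis using that[of a b] that[of b a] by (auto simp: insert_commute)
qed

lemma across_flags: "g \<in> flags \<Longrightarrow> across T g \<in> flags"
  by (erule flagsE) (auto simp: flags_def)

lemma across_across: "g \<in> flags \<Longrightarrow> across T (across T g) = g"
  by (erule flagsE) auto

lemma rho_permutes: "x \<in> N \<Longrightarrow> \<rho> x permutes incident_edges G x"
  using ribbon by (auto simp: ribbon_structure_def)

lemma flags_iff: "(x, \<epsilon>) \<in> flags \<longleftrightarrow> x \<in> N \<and> \<epsilon> \<in> incident_edges G x"
  using edges by (force simp: flags_def incident_edges_def)

lemma turn_flags: "g \<in> flags \<Longrightarrow> turn g \<in> flags"
  by (cases g) (simp add: flags_iff permutes_in_image[OF rho_permutes])

lemma inj_on_turn: "inj_on turn flags"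
proof (rule inj_onI)
  fix g h assume "g \<in> flags" "h \<in> flags" "turn g = turn h"
  then show "g = h"
    by (cases g; cases h) (auto simp: flags_iff dest: injD[OF permutes_inj[OF rho_permutes]])
qed

lemma inj_on_tour_step: "inj_on (tour_step T) flags"
proof (rule inj_onI)
  fix g h assume *: "g \<in> flags" "h \<in> flags" "tour_step T g = tour_step T h"
  then have "across T g = across T h"
    unfolding tour_step_def using inj_on_turn across_flags by (metis inj_onD)
  with * show "g = h" by (metis across_across)
qed

lemma tour_step_flags: "tour_step T ` flags \<subseteq> flags"
  unfolding tour_step_def using across_flags turn_flags by blast

lemma ex_funpow_rho:
  assumes "x \<in> N" "\<epsilon> \<in> incident_edges G x" "\<delta> \<in> incident_edges G x"
  shows "\<exists>n>0. \<delta> = (\<rho> x ^^ n) \<epsilon>"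
proof -
  have "cyclic_on (\<rho> x) (incident_edges G x)"
    using ribbon assms by (auto simp: ribbon_structure_def)
  then have "\<delta> \<in> orbit (\<rho> x) \<epsilon>" using assms by (auto simp: cyclic_on_alldef)
  then show ?thesis by (auto simp: orbit_altdef)
qed

end

locale tree_tour = bipartite_ribbon +
  fixes T :: "'a set set" and s :: "'a \<times> 'a set"
  assumes tree_subset: "T \<subseteq> G" and tree_connected: "connected_graph N T"
    and tree_card: "card T + 1 = card N" and start: "s \<in> flags"
begin

sublocale T: finite_graph N T
  by (rule subgraph[OF tree_subset])

definition tour :: "nat \<Rightarrow> 'a \<times> 'a set" where
  "tour k = (tour_step T ^^ k) s"

lemma tour_0 [simp]: "tour 0 = s"
  and tour_Suc: "tour (Suc k) = turn (across T (tour k))"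
  by (auto simp: tour_def tour_step_def)

lemma tour_flags: "tour k \<in> flags"
  by (induction k) (auto simp: tour_Suc start across_flags turn_flags)

text \<open>A step changes the node only by crossing a tree edge, and \<open>{a, b}\<close> is the
  only tree edge between \<open>B\<close> and its complement.\<close>

lemma enter_cut:
  assumes "\<forall>u w. {u, w} \<in> T \<longrightarrow> {u, w} \<noteq> {a, b} \<longrightarrow> u \<in> B \<longrightarrow> w \<in> B" "a \<notin> B"
    "g \<in> flags" "fst g \<notin> B" "fst (tour_step T g) \<in> B"
  shows "g = (a, {a, b})"
proof -
  obtain u w where g: "g = (u, {u, w})" using flagsE[OF assms(3)] by metis
  have uw: "{u, w} \<in> T" "w \<in> B" using assms(4,5) by (auto simp: g tour_step_def split: if_splits)
  then have "{w, u} = {a, b}" using assms(1)[rule_format, of w u] assms(4) by (auto simp: g insert_commute)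
  with uw assms(2) show ?thesis by (auto simp: g doubleton_eq_iff)
qed

lemma leave_cut:
  assumes "\<forall>u w. {u, w} \<in> T \<longrightarrow> {u, w} \<noteq> {a, b} \<longrightarrow> u \<in> B \<longrightarrow> w \<in> B" "a \<notin> B"
    "g \<in> flags" "fst g \<in> B" "fst (tour_step T g) \<notin> B"
  shows "g = (b, {a, b})"
proof -
  obtain u w where g: "g = (u, {u, w})" using flagsE[OF assms(3)] by metis
  have uw: "{u, w} \<in> T" "w \<notin> B" using assms(4,5) by (auto simp: g tour_step_def split: if_splits)
  then have "{u, w} = {a, b}" using assms(1)[rule_format, of u w] assms(4) by (auto simp: g)
  with uw assms(2,4) show ?thesis by (auto simp: g doubleton_eq_iff)
qed

text \<open>A closed orbit that uses a tree edge in one direction has to return across it.\<close>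

lemma across_range_tour:
  assumes "g \<in> range tour"
  shows "across T g \<in> range tour"
proof -
  from assms obtain k where k: "g = tour k" by blast
  obtain a b where g: "g = (a, {a, b})" using flagsE[OF tour_flags[of k]] k by metis
  show ?thesis
  proof (cases "{a, b} \<in> T")
    case False
    then show ?thesis using assms by (simp add: g)
  next
    case True
    from T.tree_cut[OF tree_connected tree_card True] obtain B where
      B: "b \<in> B" "a \<notin> B" "\<forall>u w. {u, w} \<in> T \<longrightarrow> {u, w} \<noteq> {a, b} \<longrightarrow> u \<in> B \<longrightarrow> w \<in> B"
      by metis
    have step: "tour_step T (tour i) = tour (Suc i)" for i by (simp add: tour_def)
    obtain n where n: "n > 0" "(tour_step T ^^ n) g = g"
      using inj_on_funpow_returns[OF inj_on_tour_step tour_step_flags finite_flags] tour_flags k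
      by blast
    then have n': "tour (n + k) = g" by (simp add: tour_def k funpow_add)
    \<comment> \<open>Without this flag the tour could never leave \<open>B\<close> after entering
      it from \<open>a\<close>, so it could not come back to \<open>g\<close>.\<close>
    have "\<exists>i. tour i = (b, {a, b})"
    proof (rule ccontr)
      assume "\<nexists>i. tour i = (b, {a, b})"
      then have stay: "fst (tour (Suc i)) \<in> B" if "fst (tour i) \<in> B" for i
        using leave_cut[OF B(3,2) tour_flags that] unfolding step by blast
      have "fst (tour (Suc k)) \<in> B" using B True by (simp add: tour_Suc k[symmetric] g)
      then have "fst (tour (Suc k + i)) \<in> B" for i by (induction i) (auto intro: stay)
      from this[of "n - 1"] have "fst g \<in> B" using n' n(1) by (simp add: add.commute)
      with B(2) g show False by simp
    qed
    then show ?thesis using True by (auto simp: g) (metis rangeI)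
  qed
qed

lemma turn_range_tour:
  assumes "g \<in> range tour" shows "turn g \<in> range tour"
proof -
  have "g \<in> flags" using assms tour_flags by auto
  obtain k where "across T g = tour k" using across_range_tour[OF assms] by blast
  then have "turn g = tour (Suc k)" by (metis \<open>g \<in> flags\<close> across_across tour_Suc)
  then show ?thesis by blast
qed

text \<open>The range is closed under turning and crossing. Turning reaches every flag at a visited
  node because the rotation is cyclic, and crossing reaches every node because the tree is
  connected.\<close>

lemma range_tour: "range tour = flags"
proof
  show "range tour \<subseteq> flags" using tour_flags by blast
next
  have rot: "(x, \<delta>) \<in> range tour" if "(x, \<epsilon>) \<in> range tour" "(x, \<delta>) \<in> flags" for x \<epsilon> \<delta>
  proof -
    have "(x, \<epsilon>) \<in> flags" using that tour_flags by force
    with that(2) obtain n where \<delta>: "\<delta> = (\<rho> x ^^ n) \<epsilon>"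
      using ex_funpow_rho by (meson flags_iff)
    have "(x, (\<rho> x ^^ i) \<epsilon>) \<in> range tour" for i
      by (induction i) (use that(1) turn_range_tour in force)+
    then show ?thesis using \<delta> by blast
  qed
  obtain x0 \<epsilon>0 where s: "s = (x0, \<epsilon>0)" by (cases s)
  have "\<exists>\<epsilon>. (z, \<epsilon>) \<in> range tour" if "(x0, z) \<in> (adj T)\<^sup>*" for z
    using that
  proof (induction rule: rtrancl_induct)
    case base
    show ?case using tour_0 s by (metis rangeI)
  next
    case (step z w)
    then obtain \<epsilon> where "(z, \<epsilon>) \<in> range tour" by blast
    moreover have "(z, {z, w}) \<in> flags" using step tree_subset by (auto simp: flags_def)
    ultimately have "(z, {z, w}) \<in> range tour" by (rule rot)
    from across_range_tour[OF this] show ?case using step by auto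
  qed
  moreover have "(x0, z) \<in> (adj T)\<^sup>*" if "z \<in> N" for z
    using tree_connected start that unfolding connected_graph_def s flags_iff by blast
  ultimately show "flags \<subseteq> range tour" using rot flags_iff by (metis subrelI)
qed

definition len :: nat where "len = card flags"

lemma tour_bij: "bij_betw tour {..<len} flags" and tour_len: "tour len = s"
proof -
  have "flags \<subseteq> range (\<lambda>k. (tour_step T ^^ k) s)" using range_tour by (simp add: tour_def)
  from funpow_single_cycle[OF inj_on_tour_step tour_step_flags finite_flags start this]
  show "bij_betw tour {..<len} flags" "tour len = s" by (simp_all add: tour_def[abs_def] len_def)
qed

lemma len_pos: "0 < len"
  using start finite_flags by (auto simp: len_def card_gt_0_iff)

lemma tour_eqD: "tour i = tour j \<Longrightarrow> i < len \<Longrightarrow> j < len \<Longrightarrow> i = j"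
  using tour_bij by (auto simp: bij_betw_def inj_on_def)

lemma flag_index:
  assumes "g \<in> flags" obtains i where "i < len" "tour i = g"
  using assms tour_bij unfolding bij_betw_def by (metis imageE lessThan_iff)

text \<open>Each flag occurs once per round, so the side \<open>B\<close> away from the start is
  entered once, after index \<open>i\<close>, and left once, after index \<open>j\<close>. It is
  visited during one interval.\<close>

lemma tour_cut:
  assumes B: "\<forall>u w. {u, w} \<in> T \<longrightarrow> {u, w} \<noteq> {a, b} \<longrightarrow> u \<in> B \<longrightarrow> w \<in> B" "b \<in> B" "a \<notin> B"
    and ab: "{a, b} \<in> T" and s: "fst s \<notin> B"
    and i: "i < len" "tour i = (a, {a, b})" and j: "j < len" "tour j = (b, {a, b})"
    and k: "k < len"
  shows "fst (tour k) \<in> B \<longleftrightarrow> i < k \<and> k \<le> j"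
proof -
  have step: "tour_step T (tour i) = tour (Suc i)" for i by (simp add: tour_def)
  have enter: "m = i" if "fst (tour m) \<notin> B" "fst (tour (Suc m)) \<in> B" "m < len" for m
    using enter_cut[OF B(1,3) tour_flags that(1)] that i tour_eqD[of m i] unfolding step by simp
  have leave: "m = j" if "fst (tour m) \<in> B" "fst (tour (Suc m)) \<notin> B" "m < len" for m
    using leave_cut[OF B(1,3) tour_flags that(1)] that j tour_eqD[of m j] unfolding step by simp
  have before: "fst (tour m) \<notin> B" if "m \<le> i" for m
    using that
  proof (induction m)
    case 0
    then show ?case using s by simp
  next
    case (Suc m)
    then show ?case using enter[of m] i by fastforce
  qed
  have ij: "i < j" using before[of j] j B by force
  have inside: "fst (tour (Suc i + m)) \<in> B" if "Suc i + m \<le> j" for m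
    using that
  proof (induction m)
    case 0
    then show ?case using i ab B by (simp add: tour_Suc)
  next
    case (Suc m)
    then show ?case using leave[of "Suc i + m"] j by fastforce
  qed
  have after: "fst (tour (Suc j + m)) \<notin> B" if "Suc j + m < len" for m
    using that
  proof (induction m)
    case 0
    then show ?case using j ab B by (simp add: tour_Suc)
  next
    case (Suc m)
    then show ?case using enter[of "Suc j + m"] ij by fastforce
  qed
  consider "k \<le> i" | m where "k = Suc i + m" "k \<le> j" | m where "k = Suc j + m"
    by (metis add.commute le_Suc_ex not_less_eq_eq)
  then show ?thesis
    using before inside after k ij by cases auto
qed

end

section \<open>Jaeger trees\<close>

text \<open>At the first difference \<open>True\<close> is the larger letter.\<close>

definition lex_less :: "(nat \<Rightarrow> bool) \<Rightarrow> (nat \<Rightarrow> bool) \<Rightarrow> bool" where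
  "lex_less w w' \<longleftrightarrow> (\<exists>k. (\<forall>i<k. w i = w' i) \<and> \<not> w k \<and> w' k)"

lemma asymp_lex_less: "lex_less w w' \<Longrightarrow> \<not> lex_less w' w"
  unfolding lex_less_def by (metis linorder_neqE_nat)

lemma transp_lex_less:
  assumes "lex_less w w'" "lex_less w' w''"
  shows "lex_less w w''"
proof -
  obtain k where k: "\<forall>i<k. w i = w' i" "\<not> w k" "w' k" using assms by (auto simp: lex_less_def)
  obtain l where l: "\<forall>i<l. w' i = w'' i" "\<not> w' l" "w'' l" using assms by (auto simp: lex_less_def)
  have "\<forall>i<min k l. w i = w'' i" using k l by simp
  moreover have "\<not> w (min k l) \<and> w'' (min k l)" using k l
    by (cases k l rule: linorder_cases) (auto simp: min_def)
  ultimately show ?thesis unfolding lex_less_def by blast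
qed

locale jaeger_tour = tree_tour +
  assumes jaeger: "\<lbrakk>{x, y} \<notin> T; x \<in> X; y \<in> Y; i < len; tour i = (x, {x, y}); j < len; tour j = (y, {x, y})\<rbrakk>
    \<Longrightarrow> j < i"

section \<open>Reversal, degree sums and words of tours\<close>

context bipartite_ribbon
begin

lemma swap_reversed: "bipartite_ribbon N Y X G (reversed \<rho>)"
proof
  show "finite N" "N = Y \<union> X" "Y \<inter> X = {}" using finite_N N_eq disjoint by auto
  show "\<exists>x\<in>Y. \<exists>y\<in>X. \<epsilon> = {x, y}" if "\<epsilon> \<in> G" for \<epsilon>
    using bipartite[OF that] by (metis insert_commute)
  show "ribbon_structure N G (reversed \<rho>)"
    unfolding ribbon_structure_def reversed_def
  proof (intro ballI conjI impI)
    fix x assume x: "x \<in> N"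
    show "inv (\<rho> x) permutes incident_edges G x" by (rule permutes_inv[OF rho_permutes[OF x]])
    assume "incident_edges G x \<noteq> {}"
    then obtain \<epsilon> where "\<epsilon> \<in> incident_edges G x" "incident_edges G x = orbit (\<rho> x) \<epsilon>"
      using ribbon x by (auto simp: ribbon_structure_def cyclic_on_def)
    moreover have "finite (incident_edges G x)" using finite_edges by (simp add: incident_edges_def)
    then have "permutation (\<rho> x)" using rho_permutes[OF x] permutation_permutes by blast
    ultimately show "cyclic_on (inv (\<rho> x)) (incident_edges G x)"
      by (metis cyclic_on_def orbit_inv_eq)
  qed
qed

lemma edge_ends:
  assumes "{a, b} \<in> G"
  shows "a \<in> X \<longleftrightarrow> b \<in> Y" "a \<in> Y \<longleftrightarrow> b \<in> X"
proof -
  from bipartite[OF assms] obtain x y where "x \<in> X" "y \<in> Y" "{a, b} = {x, y}" by blast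
  then show "a \<in> X \<longleftrightarrow> b \<in> Y" "a \<in> Y \<longleftrightarrow> b \<in> X"
    using disjoint by (auto simp: doubleton_eq_iff)
qed

text \<open>An edge has only one end in \<open>X\<close>, so no edge is counted twice.\<close>

lemma card_edges_touching:
  assumes "F \<subseteq> G" "S \<subseteq> X"
  shows "card {\<epsilon> \<in> F. \<epsilon> \<inter> S \<noteq> {}} = (\<Sum>x\<in>S. degree F x)"
proof -
  have fin: "finite S" "finite F"
    using assms finite_N N_eq finite_edges by (auto intro: finite_subset)
  have "{\<epsilon> \<in> F. \<epsilon> \<inter> S \<noteq> {}} = (\<Union>x\<in>S. incident_edges F x)"
    by (auto simp: incident_edges_def)
  moreover have "card (\<Union>x\<in>S. incident_edges F x) = (\<Sum>x\<in>S. card (incident_edges F x))"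
  proof (rule card_UN_disjoint[OF fin(1)])
    show "\<forall>x\<in>S. finite (incident_edges F x)" using fin by (simp add: incident_edges_def)
    show "\<forall>x\<in>S. \<forall>x'\<in>S. x \<noteq> x' \<longrightarrow> incident_edges F x \<inter> incident_edges F x' = {}"
    proof (intro ballI impI)
      fix x x' assume x: "x \<in> S" "x' \<in> S" "x \<noteq> x'"
      have False if "\<epsilon> \<in> F" "x \<in> \<epsilon>" "x' \<in> \<epsilon>" for \<epsilon>
        using bipartite[of \<epsilon>] that x assms disjoint by blast
      then show "incident_edges F x \<inter> incident_edges F x' = {}"
        by (auto simp: incident_edges_def)
    qed
  qed
  ultimately show ?thesis by (simp add: degree_def)
qed

text \<open>The letter that maximization prefers: trees with maximal \<open>tour_word\<close> will
  be Jaeger trees.\<close>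

definition favourable :: "'n set set \<Rightarrow> 'n \<times> 'n set \<Rightarrow> bool" where
  "favourable T g \<longleftrightarrow> (fst g \<in> Y \<longleftrightarrow> snd g \<notin> T)"

definition tour_word :: "'n \<times> 'n set \<Rightarrow> 'n set set \<Rightarrow> nat \<Rightarrow> bool" where
  "tour_word s T k = favourable T ((tour_step T ^^ k) s)"

end

section \<open>Exchange of tree edges\<close>

context tree_tour
begin

lemma nodes_nonempty: "N \<noteq> {}"
  using start edge_nodes by (auto elim: flagsE)

lemma spanning_tree_T: "spanning_tree N G T"
  using spanning_tree_iff[OF nodes_nonempty] tree_subset tree_connected tree_card by blast

text \<open>A tour depends on its tree only through membership of the edges met so far.\<close>

lemma tour_agree:
  assumes "\<And>m. m < k \<Longrightarrow> snd (tour m) \<in> T \<longleftrightarrow> snd (tour m) \<in> T'" "m \<le> k"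
  shows "(tour_step T' ^^ m) s = tour m"
  using assms(2)
proof (induction m)
  case (Suc m)
  with assms(1)[of m] show ?case
    by (cases "tour m") (auto simp: tour_Suc tour_step_def)
qed simp

lemma first_edge_towards:
  assumes "x \<in> N" "y \<in> N" "x \<noteq> y"
  shows "\<exists>z. {x, z} \<in> T \<and> (z, y) \<in> (adj (T - {{x, z}}))\<^sup>*"
proof -
  have "(x, y) \<in> (adj T)\<^sup>*" using assms tree_connected by (auto simp: connected_graph_def)
  then have "y = x \<or> ?thesis"
  proof (induction rule: rtrancl_induct)
    case (step y y')
    show ?case
    proof (cases "y' = x \<or> y = x")
      case True
      then show ?thesis using step.hyps(2) by auto
    next
      case False
      with step.IH obtain z where z: "{x, z} \<in> T" "(z, y) \<in> (adj (T - {{x, z}}))\<^sup>*" by blast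
      have "{y, y'} \<noteq> {x, z}" using False by (auto simp: doubleton_eq_iff)
      with step.hyps(2) have "(y, y') \<in> adj (T - {{x, z}})" by simp
      with z show ?thesis by (meson rtrancl.rtrancl_into_rtrancl)
    qed
  qed simp
  with assms show ?thesis by blast
qed

text \<open>This is \<open>tour_cut\<close> for the complement of \<open>B\<close>, with the ends of
  the edge exchanged.\<close>

lemma tour_cut':
  assumes B: "\<forall>u w. {u, w} \<in> T \<longrightarrow> {u, w} \<noteq> {a, b} \<longrightarrow> u \<in> B \<longrightarrow> w \<in> B" "b \<in> B" "a \<notin> B"
    and ab: "{a, b} \<in> T" and s: "fst s \<in> B"
    and i: "i < len" "tour i = (a, {a, b})" and j: "j < len" "tour j = (b, {a, b})"
    and k: "k < len"
  shows "fst (tour k) \<notin> B \<longleftrightarrow> j < k \<and> k \<le> i"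
proof -
  have ba: "{b, a} = {a, b}" by auto
  have "fst (tour k) \<in> - B \<longleftrightarrow> j < k \<and> k \<le> i"
  proof (rule tour_cut[of b a])
    show "\<forall>u w. {u, w} \<in> T \<longrightarrow> {u, w} \<noteq> {b, a} \<longrightarrow> u \<in> - B \<longrightarrow> w \<in> - B"
      using B(1) unfolding ba by (metis ComplD ComplI insert_commute)
  qed (use assms ba in auto)
  then show ?thesis by simp
qed

text \<open>A non-tree edge \<open>{x, y}\<close> first met at \<open>x \<in> X\<close> replaces the first edge of the tree path from
  \<open>x\<close> to \<open>y\<close>. The first flag where the two tours differ belongs to \<open>x\<close> and is now kept, or it
  belongs to \<open>Y\<close> and is now skipped.\<close>

lemma exchange:
  assumes "{x, y} \<notin> T" "x \<in> X" "y \<in> Y" "i < j" "j < len"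
    "tour i = (x, {x, y})" "tour j = (y, {x, y})"
  shows "\<exists>T'. spanning_tree N G T' \<and> (\<forall>v\<in>X. degree T' v = degree T v)
    \<and> lex_less (tour_word s T) (tour_word s T')"
proof -
  have xy: "{x, y} \<in> G" "x \<noteq> y" "x \<in> N" "y \<in> N"
    using tour_flags[of i] assms N_eq disjoint by (auto simp: flags_def)
  obtain z where z: "{x, z} \<in> T" "(z, y) \<in> (adj (T - {{x, z}}))\<^sup>*"
    using first_edge_towards xy by blast
  then have xz: "{x, z} \<in> G" "z \<in> Y" "x \<noteq> z"
    using tree_subset edge_ends[of x z] assms(2) T.edge_neq by auto
  have neq: "{x, y} \<noteq> {x, z}" "y \<noteq> z" using z assms(1) by auto
  from T.tree_cut[OF tree_connected tree_card z(1)] obtain B where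
    B: "z \<in> B" "x \<notin> B" "\<forall>u w. {u, w} \<in> T \<longrightarrow> {u, w} \<noteq> {x, z} \<longrightarrow> u \<in> B \<longrightarrow> w \<in> B" by metis
  have yB: "y \<in> B"
    using z(2) by (induction rule: rtrancl_induct) (use B in auto)
  define T' where "T' = insert {x, y} (T - {{x, z}})"
  have mem: "\<epsilon> \<in> T' \<longleftrightarrow> \<epsilon> \<in> T" if "\<epsilon> \<noteq> {x, y}" "\<epsilon> \<noteq> {x, z}" for \<epsilon>
    using that by (auto simp: T'_def)
  have "connected_graph N T'"
    using tree_connected
  proof (rule connected_graph_replace)
    fix c d assume cd: "{c, d} \<in> T"
    show "(c, d) \<in> (adj T')\<^sup>*"
    proof (cases "{c, d} = {x, z}")
      case False
      with cd show ?thesis by (intro r_into_rtrancl) (auto simp: T'_def)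
    next
      case True
      have "(adj (T - {{x, z}}))\<^sup>* \<subseteq> (adj T')\<^sup>*" by (rule rtrancl_mono) (auto simp: T'_def)
      moreover have "(y, z) \<in> (adj (T - {{x, z}}))\<^sup>*" using z(2) by (rule adj_rtrancl_sym)
      moreover have "(x, y) \<in> adj T'" by (simp add: T'_def)
      ultimately have "(x, z) \<in> (adj T')\<^sup>*"
        by (meson converse_rtrancl_into_rtrancl subsetD)
      then show ?thesis using True adj_rtrancl_sym[of x z T'] by (auto simp: doubleton_eq_iff)
    qed
  qed
  moreover have "card T' = card T"
    unfolding T'_def using T.finite_edges z(1) assms(1)
    by (simp add: card_Diff_singleton card_insert_if) (metis card_Suc_Diff1 card_Diff_singleton One_nat_def)
  moreover have "T' \<subseteq> G" using tree_subset xy by (auto simp: T'_def)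
  ultimately have T': "spanning_tree N G T'"
    using spanning_tree_iff[OF nodes_nonempty] tree_card by simp
  have deg: "degree T' v = degree T v" if "v \<in> X" for v
  proof (cases "v = x")
    case False
    then have "v \<notin> {x, y}" "v \<notin> {x, z}" using that assms xz disjoint by auto
    then have "incident_edges T' v = incident_edges T v" by (auto simp: incident_edges_def T'_def)
    then show ?thesis by (simp add: degree_def)
  next
    case True
    have "incident_edges T' v = insert {x, y} (incident_edges T v - {{x, z}})"
      by (auto simp: incident_edges_def T'_def True)
    moreover have "{x, z} \<in> incident_edges T v" "{x, y} \<notin> incident_edges T v"
      using z assms by (auto simp: incident_edges_def True)
    moreover have "finite (incident_edges T v)" using T.finite_edges by (simp add: incident_edges_def)
    ultimately show ?thesis
      unfolding degree_def by (metis DiffD1 card_Suc_Diff1 card_insert_disjoint finite_Diff)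
  qed
  have flags: "(x, {x, z}) \<in> flags" "(z, {x, z}) \<in> flags" using xz by (auto simp: flags_def)
  obtain p where p: "p < len" "tour p = (x, {x, z})" using flag_index[OF flags(1)] .
  obtain q where q: "q < len" "tour q = (z, {x, z})" using flag_index[OF flags(2)] .
  have i: "i < len" using assms by linarith
  have which: "m \<in> {i, j}" if "snd (tour m) = {x, y}" "m < len" for m
  proof -
    have "tour m = tour i \<or> tour m = tour j"
      using that tour_flags[of m] assms(6,7) by (cases "tour m") (auto simp: flags_def)
    then show ?thesis using tour_eqD that i assms(5) by blast
  qed
  have which': "m \<in> {p, q}" if "snd (tour m) = {x, z}" "m < len" for m
  proof -
    have "tour m = tour p \<or> tour m = tour q"
      using that tour_flags[of m] p q by (cases "tour m") (auto simp: flags_def)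
    then show ?thesis using tour_eqD that p q by blast
  qed
  \<comment> \<open>Only the edges \<open>{x, y}\<close> and \<open>{x, z}\<close> distinguish the
    trees, so before the first of the indices \<open>i\<close>, \<open>j\<close>, \<open>p\<close>,
    \<open>q\<close> both tours agree.\<close>
  have lex: "lex_less (tour_word s T) (tour_word s T')"
    if k: "k < len" "k \<le> i" "k \<le> j" "k \<le> p" "k \<le> q"
      "\<not> favourable T (tour k)" "favourable T' (tour k)" for k
  proof -
    have iff: "snd (tour m) \<in> T \<longleftrightarrow> snd (tour m) \<in> T'" if "m < k" for m
      using which[of m] which'[of m] k that mem[of "snd (tour m)"] by auto
    have "tour_word s T' m = favourable T' (tour m)" if "m \<le> k" for m
      using tour_agree[OF iff that] by (simp add: tour_word_def)
    moreover have "tour_word s T m = favourable T (tour m)" for m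
      by (simp add: tour_word_def tour_def)
    ultimately show ?thesis
      unfolding lex_less_def using k iff by (intro exI[of _ k]) (auto simp: favourable_def)
  qed
  have "lex_less (tour_word s T) (tour_word s T')"
  proof (cases "fst s \<in> B")
    case False
    note cut = tour_cut[OF B(3,1,2) z(1) False p q]
    \<comment> \<open>The tour is in \<open>B\<close> exactly from after \<open>p\<close> to
      \<open>q\<close>. It contains \<open>j\<close> but not \<open>i\<close>, and
      \<open>i < j\<close>, so \<open>i\<close> comes first among the four indices.\<close>
    have "p < j" "j \<le> q" using cut[of j] assms yB by auto
    moreover have "i \<le> p" using cut[of i] i assms B \<open>j \<le> q\<close> by auto
    moreover have "x \<notin> Y" using assms disjoint by auto
    ultimately show ?thesis
      using i assms neq by (intro lex[of i]) (auto simp: favourable_def T'_def)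
  next
    case True
    note cut = tour_cut'[OF B(3,1,2) z(1) True p q]
    \<comment> \<open>Here the tour is outside \<open>B\<close> exactly from after \<open>q\<close>
      to \<open>p\<close>, and \<open>i\<close> and \<open>p\<close> both lie there. So
      \<open>q\<close> comes first, at the flag of \<open>z\<close> in \<open>Y\<close> whose edge
      is now skipped.\<close>
    have "q < i" using cut[of i] i assms B by auto
    moreover have "q < p" using cut[of p] p B by auto
    ultimately show ?thesis
      using q assms neq xz z by (intro lex[of q]) (auto simp: favourable_def T'_def)
  qed
  with T' deg show ?thesis by blast
qed

end

lemma (in bipartite_ribbon) ex_jaeger_tour:
  assumes "s \<in> flags" "hypertree_on N X G f"
  shows "\<exists>T. jaeger_tour N X Y G \<rho> T s \<and> (\<forall>x\<in>X. degree T x = f x + 1)"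
proof -
  define A where "A = {T. spanning_tree N G T \<and> (\<forall>x\<in>X. degree T x = f x + 1)}"
  have "N \<noteq> {}" using assms(1) by (auto elim: flagsE)
  have "A \<subseteq> Pow G" by (auto simp: A_def spanning_tree_def)
  then have "finite A" using finite_edges by (metis finite_Pow_iff finite_subset)
  moreover have "A \<noteq> {}" using assms(2) by (auto simp: A_def hypertree_on_def)
  ultimately have "\<exists>T\<in>A. \<forall>T'\<in>A. T' \<noteq> T \<longrightarrow> \<not> lex_less (tour_word s T) (tour_word s T')"
    by (intro Finite_Set.bex_max_element)
      (auto intro!: asymp_onI transp_onI dest: asymp_lex_less intro: transp_lex_less)
  then obtain T where T: "T \<in> A"
    and max: "\<And>T'. T' \<in> A \<Longrightarrow> \<not> lex_less (tour_word s T) (tour_word s T')"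
    using asymp_lex_less by metis
  interpret tree_tour N X Y G \<rho> T s
    by unfold_locales
      (use T spanning_tree_iff[OF \<open>N \<noteq> {}\<close>, of T] assms(1) in \<open>auto simp: A_def\<close>)
  have "jaeger_tour N X Y G \<rho> T s"
  proof
    fix x y i j
    assume *: "{x, y} \<notin> T" "x \<in> X" "y \<in> Y" "i < len" "tour i = (x, {x, y})" "j < len"
      "tour j = (y, {x, y})"
    show "j < i"
    proof (rule ccontr)
      assume "\<not> j < i"
      moreover have "i \<noteq> j" using * disjoint by auto
      ultimately have "i < j" by simp
      from exchange[OF *(1-3) this *(6,5,7)] obtain T' where "spanning_tree N G T'"
        "\<forall>v\<in>X. degree T' v = degree T v" "lex_less (tour_word s T) (tour_word s T')" by blast
      with max[of T'] T show False by (auto simp: A_def)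
    qed
  qed
  with T show ?thesis by (auto simp: A_def)
qed

text \<open>The tour in the reversed ribbon structure passes the flags of the original tour backwards,
  up to exchanging the two flags of each tree edge.\<close>

lemma (in jaeger_tour) jaeger_tour_reversed:
  "jaeger_tour N Y X G (reversed \<rho>) T (fst s, inv (\<rho> (fst s)) (snd s))"
proof -
  interpret R: bipartite_ribbon N Y X G "reversed \<rho>" by (rule swap_reversed)
  have reversed_eq: "reversed \<rho> x = inv (\<rho> x)" for x
    by (simp add: reversed_def)
  have R_turn: "R.turn (turn g) = g" if "g \<in> flags" for g
    using that by (cases g) (auto simp: reversed_eq flags_iff permutes_inverses[OF rho_permutes])
  let ?s = "(fst s, inv (\<rho> (fst s)) (snd s))"
  have s: "?s = R.turn s" by (cases s) (simp add: reversed_eq)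
  interpret R: tree_tour N Y X G "reversed \<rho>" T ?s
    by unfold_locales (use tree_subset tree_connected tree_card s R.turn_flags[OF start] in auto)
  \<comment> \<open>The tour is closed, so the flag before \<open>s\<close> is
    \<open>tour (len - 1)\<close>. Undoing the turn leaves a crossing of that flag, and crossing is
    an involution.\<close>
  have R_tour: "R.tour m = across T (tour (len - 1 - m))" if "m < len" for m
    using that
  proof (induction m)
    case 0
    have "s = turn (across T (tour (len - 1)))"
      using tour_len len_pos tour_Suc[of "len - 1"] by simp
    then show ?case using R_turn across_flags tour_flags by (metis R.tour_0 diff_zero s)
  next
    case (Suc m)
    then have "tour (len - 1 - m) = turn (across T (tour (len - 1 - Suc m)))"
      using tour_Suc[of "len - 1 - Suc m"] by (simp add: Suc_diff_Suc)
    with Suc show ?case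
      by (metis R.tour_Suc R_turn Suc_lessD across_across across_flags tour_flags)
  qed
  show ?thesis
  proof
    fix x y i j
    assume *: "{x, y} \<notin> T" "x \<in> Y" "y \<in> X" "i < R.len" "R.tour i = (x, {x, y})" "j < R.len"
      "R.tour j = (y, {x, y})"
    have R_len: "R.len = len" by (simp add: len_def R.len_def)
    \<comment> \<open>Crossing does nothing at a non-tree edge, so these flags are passed in exactly
      the reverse order.\<close>
    have "tour (len - 1 - m) = g" if "R.tour m = g" "snd g \<notin> T" "m < len" for m g
      using R_tour[OF that(3)] that(1,2) across_across[OF tour_flags]
      by (metis across.simps surjective_pairing)
    then have "tour (len - 1 - i) = (x, {y, x})" "tour (len - 1 - j) = (y, {y, x})"
      using * R_len by (auto simp: insert_commute)
    from jaeger[OF _ *(3,2) _ this(2) _ this(1)] *(1) have "len - 1 - i < len - 1 - j"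
      using len_pos by (simp add: insert_commute)
    then show "j < i" by linarith
  qed
qed

section \<open>The Bernardi process follows the tour of a Jaeger tree\<close>

context jaeger_tour
begin

text \<open>The expected current graph when the process arrives at the flag with index
  \<open>k\<close>: edges are cut only at their ends in \<open>Y\<close>.\<close>

definition remaining :: "nat \<Rightarrow> 'a set set" where
  "remaining k = G - {\<epsilon>. \<epsilon> \<notin> T \<and> (\<exists>i<k. \<exists>y\<in>Y. tour i = (y, \<epsilon>))}"

text \<open>Flags of non-tree edges are passed by the tour too, but their edges are not
  traversed.\<close>

definition traversed :: "nat \<Rightarrow> ('a \<times> 'a) set" where
  "traversed k = {(a, b). {a, b} \<in> T \<and> (\<exists>i<k. tour i = (a, {a, b}))}"

lemma tree_remaining: "T \<subseteq> remaining k"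
  using tree_subset by (auto simp: remaining_def)

lemma not_remainingI:
  "\<epsilon> \<notin> T \<Longrightarrow> i < k \<Longrightarrow> y \<in> Y \<Longrightarrow> tour i = (y, \<epsilon>) \<Longrightarrow> \<epsilon> \<notin> remaining k"
  by (auto simp: remaining_def)

lemma remaining_eq:
  assumes "k \<le> l" "\<And>i. k \<le> i \<Longrightarrow> i < l \<Longrightarrow> fst (tour i) \<in> Y \<Longrightarrow> snd (tour i) \<in> T"
  shows "remaining l = remaining k"
proof -
  have "(\<exists>i<l. \<exists>y\<in>Y. tour i = (y, \<epsilon>)) \<longleftrightarrow> (\<exists>i<k. \<exists>y\<in>Y. tour i = (y, \<epsilon>))" if "\<epsilon> \<notin> T" for \<epsilon>
    using assms that by (metis fst_conv less_le_trans not_less snd_conv)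
  then show ?thesis unfolding remaining_def by blast
qed

lemma edge_split:
  assumes "\<epsilon> \<in> G"
  obtains x y where "x \<in> X" "y \<in> Y" "\<epsilon> = {x, y}" "(x, {x, y}) \<in> flags" "(y, {x, y}) \<in> flags"
proof -
  from bipartite[OF assms] obtain x y where "x \<in> X" "y \<in> Y" "\<epsilon> = {x, y}" by blast
  then show ?thesis using assms that[of x y] by (auto simp: flags_def)
qed

text \<open>A full round meets every edge at its end in \<open>Y\<close>.\<close>

lemma remaining_len: "remaining len = T"
proof
  show "remaining len \<subseteq> T"
  proof
    fix \<epsilon> assume \<epsilon>: "\<epsilon> \<in> remaining len"
    then have "\<epsilon> \<in> G" by (simp add: remaining_def)
    then obtain x y where "x \<in> X" "y \<in> Y" "\<epsilon> = {x, y}" "(y, {x, y}) \<in> flags"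
      by (rule edge_split)
    moreover then obtain j where "j < len" "tour j = (y, {x, y})" using flag_index by blast
    ultimately show "\<epsilon> \<in> T" using \<epsilon> by (auto simp: remaining_def)
  qed
qed (rule tree_remaining)

lemma jaeger_index:
  assumes "\<epsilon> \<notin> T" "i < len" "tour i = (x, \<epsilon>)" "x \<in> X"
  obtains y j where "y \<in> Y" "\<epsilon> = {x, y}" "j < i" "tour j = (y, \<epsilon>)"
proof -
  have \<epsilon>: "\<epsilon> \<in> G" "x \<in> \<epsilon>" using tour_flags[of i] assms(3) by (auto simp: flags_def)
  obtain x' y where xy: "x' \<in> X" "y \<in> Y" "\<epsilon> = {x', y}" "(y, {x', y}) \<in> flags"
    by (rule edge_split[OF \<epsilon>(1)])
  then have "x' = x" using \<epsilon>(2) assms(4) disjoint by auto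
  obtain j where j: "j < len" "tour j = (y, {x', y})" using flag_index[OF xy(4)] .
  have "j < i"
    by (rule jaeger[of x y]) (use assms xy j \<open>x' = x\<close> in auto)
  then show ?thesis using that xy j \<open>x' = x\<close> by auto
qed

text \<open>A non-tree edge at a start in \<open>X\<close> would have to be met before index
  0.\<close>

lemma start_edge_in_tree: "fst s \<in> X \<Longrightarrow> snd s \<in> T"
  using jaeger_index[of "snd s" 0 "fst s"] len_pos by (metis not_less_zero surjective_pairing tour_0)

text \<open>An edge can be cut only at its single end in \<open>Y\<close>, and the tour is at that
  flag only at index \<open>j\<close>.\<close>

lemma fresh_edge:
  assumes "tour j = (y, \<delta>)" "y \<in> Y" "j < len" "k \<le> j"
  shows "\<delta> \<in> remaining k"
proof -
  have \<delta>: "\<delta> \<in> G" "y \<in> \<delta>" using tour_flags[of j] assms(1) by (auto simp: flags_def)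
  have "y' = y" if "y' \<in> Y" "tour i = (y', \<delta>)" for i y'
  proof -
    have "y' \<in> \<delta>" using tour_flags[of i] that by (auto simp: flags_def)
    moreover obtain a b where "a \<in> X" "b \<in> Y" "\<delta> = {a, b}" using bipartite[OF \<delta>(1)] by blast
    ultimately show ?thesis using \<delta>(2) that(1) assms(2) disjoint by auto
  qed
  moreover have "tour i \<noteq> (y, \<delta>)" if "i < k" for i
    using tour_eqD[of i j] assms that by auto
  ultimately have "\<not> (\<exists>i<k. \<exists>y'\<in>Y. tour i = (y', \<delta>))" by blast
  then show ?thesis using \<delta> by (simp add: remaining_def)
qed

text \<open>Let \<open>B\<close> be the part of \<open>T - {{v, e}}\<close> without the base node. If \<open>e \<in> B\<close>, then all remaining
  edges between the two parts other than \<open>{v, e}\<close> have their end in \<open>X\<close> outside \<open>B\<close>; the degrees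
  in \<open>X\<close> then force every competing tree to have too many edges. If \<open>v \<in> B\<close>, then no other edge
  between the two parts remains.\<close>

lemma tree_edge_not_removable:
  assumes k: "k < len" "tour k = (v, {v, e})" and ve: "v \<in> Y" "e \<in> X" "{v, e} \<in> T"
    and deg: "\<forall>x\<in>X. degree T x = f x + 1"
  shows "\<not> hypertree_on N X (remaining k - {{v, e}}) f"
proof
  assume "hypertree_on N X (remaining k - {{v, e}}) f"
  then obtain T2 where T2: "T2 \<subseteq> remaining k - {{v, e}}" "connected_graph N T2"
    and deg2: "\<forall>x\<in>X. degree T2 x = f x + 1"
    unfolding hypertree_on_def spanning_tree_def by blast
  then have "T2 \<subseteq> G" by (auto simp: remaining_def)
  interpret T2: finite_graph N T2 by (rule subgraph[OF \<open>T2 \<subseteq> G\<close>])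
  from T.tree_cut[OF tree_connected tree_card ve(3)] obtain B where
    B: "e \<in> B" "v \<notin> B" "\<forall>u w. {u, w} \<in> T \<longrightarrow> {u, w} \<noteq> {v, e} \<longrightarrow> u \<in> B \<longrightarrow> w \<in> B" "B \<subseteq> N" by metis
  have N: "v \<in> N" "e \<in> N" using ve N_eq by auto
  have "(e, {v, e}) \<in> flags" using ve tree_subset by (auto simp: flags_def)
  then obtain p where p: "p < len" "tour p = (e, {v, e})" by (rule flag_index)
  \<comment> \<open>A non-tree edge that remains at \<open>k\<close> is met at its end in
    \<open>Y\<close> after \<open>k\<close>, hence at its end in \<open>X\<close> later
    still.\<close>
  have indices: "\<exists>i j. i < len \<and> j < i \<and> j \<ge> k \<and> j \<noteq> k \<and> tour i = (x, {x, y}) \<and> tour j = (y, {x, y})"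
    if "{x, y} \<in> T2" "{x, y} \<notin> T" "x \<in> X" "y \<in> Y" for x y
  proof -
    have "(x, {x, y}) \<in> flags" using that \<open>T2 \<subseteq> G\<close> by (auto simp: flags_def)
    then obtain i where i: "i < len" "tour i = (x, {x, y})" by (rule flag_index)
    from jaeger_index[OF that(2) i that(3)]
    obtain y' j where j: "{x, y} = {x, y'}" "j < i" "tour j = (y', {x, y})" by metis
    then have "y' = y" by (auto simp: doubleton_eq_iff)
    with j have j': "tour j = (y, {x, y})" by simp
    have "{x, y} \<in> remaining k" using that(1) T2(1) by blast
    then have "\<not> j < k" using not_remainingI[OF that(2) _ that(4) j'] by blast
    moreover have "j \<noteq> k"
    proof
      assume "j = k"
      then have "{x, y} = {v, e}" using j' k(2) by (metis prod.inject)
      then show False using that(2) ve(3) by simp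
    qed
    ultimately show ?thesis using i j(2) j' not_less by blast
  qed
  show False
  proof (cases "fst s \<in> B")
    case False
    note cut = tour_cut[OF B(3,1,2) ve(3) False k p]
    \<comment> \<open>The visit to \<open>x\<close> lies in the interval of \<open>B\<close>, which
      begins after \<open>k\<close>. The visit to \<open>y\<close> falls between \<open>k\<close>
      and the visit to \<open>x\<close>, hence also in that interval.\<close>
    have inner: "y \<in> B" if "{x, y} \<in> T2" "x \<in> X" "y \<in> Y" "x \<in> B" for x y
    proof (rule ccontr)
      assume "y \<notin> B"
      moreover have "{x, y} \<noteq> {v, e}" using that(1) T2(1) by blast
      ultimately have "{x, y} \<notin> T" using B(3) that(4) by blast
      from indices[OF that(1) this that(2,3)] obtain i j where ij: "i < len" "j < i" "k < j"
        "tour i = (x, {x, y})" "tour j = (y, {x, y})" by auto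
      have "i \<le> p" using cut[OF ij(1)] ij that by simp
      then show False using cut[of j] ij \<open>y \<notin> B\<close> by simp
    qed
    have split: "card F = (\<Sum>x\<in>X. degree F x)" if "F \<subseteq> G" for F
    proof -
      have "{\<epsilon> \<in> F. \<epsilon> \<inter> X \<noteq> {}} = F" using bipartite that by blast
      then show ?thesis using card_edges_touching[OF that subset_refl] by simp
    qed
    have "card B \<le> card {\<epsilon> \<in> T. \<epsilon> \<inter> B \<noteq> {}}"
      using T.card_le_touching_edges tree_connected B N by blast
    \<comment> \<open>Only \<open>{v, e}\<close> crosses the cut in \<open>T\<close>, and its end in
      \<open>B\<close> is \<open>e\<close>, which is in \<open>X\<close>.\<close>
    also have "\<dots> \<le> card {\<epsilon> \<in> T. \<epsilon> \<inter> (X \<inter> B) \<noteq> {}}"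
    proof (rule card_mono)
      show "{\<epsilon> \<in> T. \<epsilon> \<inter> B \<noteq> {}} \<subseteq> {\<epsilon> \<in> T. \<epsilon> \<inter> (X \<inter> B) \<noteq> {}}"
      proof safe
        fix \<epsilon> b assume \<epsilon>: "\<epsilon> \<in> T" "b \<in> \<epsilon>" "b \<in> B" "\<epsilon> \<inter> (X \<inter> B) = {}"
        obtain x y where xy: "x \<in> X" "y \<in> Y" "\<epsilon> = {x, y}"
          using bipartite \<epsilon>(1) tree_subset by blast
        then have "x \<notin> B" "y \<in> B" using \<epsilon> by auto
        moreover have "{y, x} \<in> T" using xy \<epsilon>(1) by (simp add: insert_commute)
        ultimately have "{y, x} = {v, e}" using B(3) by blast
        then show False
          using \<open>y \<in> B\<close> B(2) xy(1) ve(1) disjoint by (auto simp: doubleton_eq_iff)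
      qed
    qed (use T.finite_edges in auto)
    also have "\<dots> = (\<Sum>x\<in>X \<inter> B. degree T x)"
      by (rule card_edges_touching[OF tree_subset]) auto
    finally have 1: "card B \<le> (\<Sum>x\<in>X \<inter> B. degree T x)" .
    have "card (N - B) \<le> card {\<epsilon> \<in> T2. \<epsilon> \<inter> (N - B) \<noteq> {}}"
      using T2.card_le_touching_edges[OF T2(2), of "N - B" e] B N by blast
    \<comment> \<open>By \<open>inner\<close>, an edge of \<open>T2\<close> that touches the outside
      of \<open>B\<close> has its end in \<open>X\<close> there.\<close>
    also have "\<dots> \<le> card {\<epsilon> \<in> T2. \<epsilon> \<inter> (X - B) \<noteq> {}}"
    proof (rule card_mono)
      show "{\<epsilon> \<in> T2. \<epsilon> \<inter> (N - B) \<noteq> {}} \<subseteq> {\<epsilon> \<in> T2. \<epsilon> \<inter> (X - B) \<noteq> {}}"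
      proof safe
        fix \<epsilon> b assume \<epsilon>: "\<epsilon> \<in> T2" "b \<in> \<epsilon>" "b \<notin> B" "\<epsilon> \<inter> (X - B) = {}"
        obtain x y where "x \<in> X" "y \<in> Y" "\<epsilon> = {x, y}" using bipartite \<epsilon>(1) \<open>T2 \<subseteq> G\<close> by blast
        then show False using inner[of x y] \<epsilon> by auto
      qed
    qed (use T2.finite_edges in auto)
    also have "\<dots> = (\<Sum>x\<in>X - B. degree T2 x)"
      by (rule card_edges_touching[OF \<open>T2 \<subseteq> G\<close>]) auto
    also have "\<dots> = (\<Sum>x\<in>X - B. degree T x)"
      by (rule sum.cong) (use deg deg2 in auto)
    finally have 2: "card (N - B) \<le> (\<Sum>x\<in>X - B. degree T x)" .
    have "finite X" using finite_N N_eq by auto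
    from sum.Int_Diff[OF this, of "degree T" B]
    have "card T = (\<Sum>x\<in>X \<inter> B. degree T x) + (\<Sum>x\<in>X - B. degree T x)"
      using split[OF tree_subset] by simp
    moreover have "card N = card B + card (N - B)"
      using B(4) finite_N by (metis card_Diff_subset card_mono finite_subset le_add_diff_inverse)
    \<comment> \<open>Adding \<open>1\<close> and \<open>2\<close> gives
      \<open>card N \<le> card T\<close>, one more than a tree allows.\<close>
    ultimately show False using 1 2 tree_card by linarith
  next
    case True
    \<comment> \<open>The tour is outside \<open>B\<close> only from after \<open>p\<close> to
      \<open>k\<close>, so everything met after \<open>k\<close> lies in \<open>B\<close>.\<close>
    note cut = tour_cut'[OF B(3,1,2) ve(3) True k p]
    obtain u w where uw: "u \<in> B" "w \<notin> B" "{u, w} \<in> T2"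
      using T2.crossing_edge[OF T2(2) B(1) N(2,1) B(2)] by blast
    then have "{u, w} \<noteq> {v, e}" using T2(1) by auto
    then have nT: "{u, w} \<notin> T" using B(3) uw by blast
    have "u \<in> X \<and> w \<in> Y \<or> w \<in> X \<and> u \<in> Y"
      using uw(3) \<open>T2 \<subseteq> G\<close> edge_ends[of u w] T2.edge_nodes[OF uw(3)] N_eq by blast
    then show False
    proof
      assume *: "u \<in> X \<and> w \<in> Y"
      from indices[OF uw(3) nT] * obtain i j where "i < len" "j < i" "k < j" "tour j = (w, {u, w})"
        by (metis le_neq_implies_less)
      then show False using cut[of j] uw by simp
    next
      assume *: "w \<in> X \<and> u \<in> Y"
      have "{w, u} \<in> T2" "{w, u} \<notin> T" using uw nT by (auto simp: insert_commute)
      from indices[OF this] * obtain i j where "i < len" "j < i" "k < j" "tour i = (w, {w, u})"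
        by (metis le_neq_implies_less)
      then show False using cut[of i] uw by simp
    qed
  qed
qed

section \<open>Simulation of the process\<close>

lemma next_edge_eq:
  assumes "0 < m" "(\<rho> x ^^ m) \<epsilon> \<in> F" "\<And>i. 0 < i \<Longrightarrow> i < m \<Longrightarrow> (\<rho> x ^^ i) \<epsilon> \<notin> F"
  shows "next_edge \<rho> F x \<epsilon> = (\<rho> x ^^ m) \<epsilon>"
proof -
  have "(LEAST k. 0 < k \<and> (\<rho> x ^^ k) \<epsilon> \<in> F) = m"
    by (rule Least_equality) (use assms not_less in blast)+
  then show ?thesis by (simp add: next_edge_def)
qed

lemma next_nbr_fresh:
  assumes "tour j = (y, \<rho> y {y, x})" "y \<in> Y" "j < len" "k \<le> j"
  obtains x' where "x' \<in> X" "tour j = (y, {y, x'})" "next_nbr \<rho> (remaining k) y x = x'"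
proof -
  have "\<rho> y {y, x} \<in> remaining k" using fresh_edge assms by blast
  then have next_e: "next_edge \<rho> (remaining k) y {y, x} = \<rho> y {y, x}"
    using next_edge_eq[of 1] by simp
  obtain a x' where "tour j = (a, {a, x'})" "{a, x'} \<in> G" by (rule flagsE[OF tour_flags])
  then have x': "\<rho> y {y, x} = {y, x'}" "{y, x'} \<in> G" using assms(1) by auto
  then have "x' \<in> X" using edge_ends assms by blast
  with that x' next_e assms(1) show ?thesis by (simp add: next_nbr_def)
qed

abbreviation run :: "('a \<Rightarrow> nat) \<Rightarrow> 'a bernardi_state \<Rightarrow> 'a bernardi_state option" where
  "run f \<equiv> while_option (\<lambda>st. \<not> bernardi_halted N X \<rho> f st) (bernardi_step N X \<rho> f)"

lemma run_halted: "bernardi_halted N X \<rho> f st \<Longrightarrow> run f st = Some st"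
  by (subst while_option_unfold) simp

lemma run_step:
  assumes "\<not> bernardi_halted N X \<rho> f st" "bernardi_step N X \<rho> f st = st'"
  shows "run f st = run f st'"
  using assms by (subst while_option_unfold) simp

lemma tree_not_hypertree:
  assumes "{w, z} \<in> T"
  shows "\<not> hypertree_on N X (T - {{w, z}}) f"
  unfolding hypertree_on_def spanning_tree_def
  using T.not_connected_remove[OF tree_card assms] connected_graph_mono by blast

text \<open>The process is compared with the tour at flags in \<open>Y\<close>. Removing an edge is
  one tour step. Keeping it corresponds to crossing to \<open>x\<close>, turning there to the next
  tree edge, and crossing back to \<open>Y\<close>.\<close>

lemma run_tour:
  assumes deg: "\<forall>x\<in>X. degree T x = f x + 1"
  shows "k < len \<Longrightarrow> tour k = (y, {y, x}) \<Longrightarrow> y \<in> Y \<Longrightarrow> x \<in> X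
    \<Longrightarrow> \<exists>r. run f (remaining k, y, x, traversed k) = Some (T, r)"
proof (induction "len - k" arbitrary: k y x rule: less_induct)
  case less
  note k = less.prems(1,2) and yx = less.prems(3,4)
  have G: "{y, x} \<in> G" using tour_flags[of k] k by (auto simp: flags_def)
  have "x \<noteq> y" using yx disjoint by auto
  show ?case
  proof (cases "{y, x} \<in> T")
    case False
    have hyper: "hypertree_on N X (remaining k - {{y, x}}) f"
      unfolding hypertree_on_def using spanning_tree_T tree_remaining[of k] False deg
      by (intro exI[of _ T]) (auto simp: spanning_tree_def)
    have next_flag: "tour (Suc k) = (y, \<rho> y {y, x})" using k False by (simp add: tour_Suc)
    have "(x, {x, y}) \<in> flags" using G by (auto simp: flags_def insert_commute)
    then obtain i where i: "i < len" "tour i = (x, {x, y})" by (rule flag_index)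
    \<comment> \<open>The flag at the other end of the removed edge is still to come, so the tour is
      not over.\<close>
    have "k < i"
      by (rule jaeger[OF _ yx(2,1) i k(1)]) (use False k in \<open>auto simp: insert_commute\<close>)
    with i have Suc: "Suc k < len" by linarith
    obtain x' where x': "x' \<in> X" "tour (Suc k) = (y, {y, x'})" "next_nbr \<rho> (remaining k) y x = x'"
      using next_nbr_fresh[OF next_flag yx(1) Suc, of k] by auto
    have "remaining (Suc k) = remaining k - {{y, x}}"
      using k yx False by (auto simp: remaining_def less_Suc_eq)
    moreover have "traversed (Suc k) = traversed k"
      using k False by (auto simp: traversed_def less_Suc_eq)
    ultimately have "run f (remaining k, y, x, traversed k)
        = run f (remaining (Suc k), y, x', traversed (Suc k))"
      by (intro run_step) (use hyper x' in auto)
    then show ?thesis using less.hyps[of "Suc k" y x'] Suc x' yx k by auto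
  next
    case True
    note keep = tree_edge_not_removable[OF k yx True deg]
    have fresh: "(y, x) \<notin> traversed k"
    proof -
      have "tour i \<noteq> (y, {y, x})" if "i < k" for i using tour_eqD[of i k] k that by auto
      then show ?thesis by (auto simp: traversed_def)
    qed
    have inc: "{x, y} \<in> incident_edges G x" using G by (auto simp: incident_edges_def insert_commute)
    have "x \<in> N" using yx N_eq by auto
    let ?P = "\<lambda>m. 0 < m \<and> (\<rho> x ^^ m) {x, y} \<in> T"
    \<comment> \<open>\<open>m\<close> counts the turns at \<open>x\<close> up to the next tree
      edge. It exists because a full rotation returns to \<open>{x, y}\<close>.\<close>
    define m where "m = (LEAST m. ?P m)"
    have "\<exists>m. ?P m" using ex_funpow_rho[OF \<open>x \<in> N\<close> inc inc] True by (metis insert_commute)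
    then have m: "0 < m" "(\<rho> x ^^ m) {x, y} \<in> T"
      and least: "\<And>i. 0 < i \<Longrightarrow> i < m \<Longrightarrow> (\<rho> x ^^ i) {x, y} \<notin> T"
      using LeastI_ex[of ?P] not_less_Least[of _ ?P] unfolding m_def by auto
    have seq: "tour (k + i) = (x, (\<rho> x ^^ i) {x, y})" if "0 < i" "i \<le> m" for i
      using that
    proof (induction i)
      case (Suc i)
      show ?case
      proof (cases "i = 0")
        case True
        then show ?thesis using k \<open>{y, x} \<in> T\<close> by (simp add: tour_Suc insert_commute)
      next
        case False
        with Suc least[of i] show ?thesis by (simp add: tour_Suc)
      qed
    qed simp
    \<comment> \<open>Otherwise the tour would have started at \<open>x\<close> with a non-tree
      edge.\<close>
    have "k + m \<le> len"
    proof (rule ccontr)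
      assume "\<not> ?thesis"
      then have i: "0 < len - k" "len - k < m" "k + (len - k) = len" using k by auto
      then have "s = (x, (\<rho> x ^^ (len - k)) {x, y})" using seq[of "len - k"] tour_len by simp
      then show False using start_edge_in_tree yx least[OF i(1,2)] by simp
    qed
    \<comment> \<open>By the Jaeger condition these edges were met in \<open>Y\<close> earlier. From
      \<open>k + 1\<close> on the tour stayed at \<open>x\<close>, so this was before
      \<open>k\<close> and they are already gone.\<close>
    have skip: "(\<rho> x ^^ i) {x, y} \<notin> remaining k" if i: "0 < i" "i < m" for i
    proof -
      have "k + i < len" using i \<open>k + m \<le> len\<close> by linarith
      moreover have "tour (k + i) = (x, (\<rho> x ^^ i) {x, y})" using seq i by simp
      ultimately obtain y' j where j: "y' \<in> Y" "j < k + i" "tour j = (y', (\<rho> x ^^ i) {x, y})"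
        using jaeger_index[OF least[OF i] _ _ yx(2)] by metis
      have "\<not> k < j"
      proof
        assume "k < j"
        then have "tour j = (x, (\<rho> x ^^ (j - k)) {x, y})" using seq[of "j - k"] j i by simp
        then show False using j yx disjoint by auto
      qed
      moreover have "j \<noteq> k" using j k least[OF i] True by auto
      ultimately show ?thesis using not_remainingI[OF least[OF i] _ j(1,3)] by simp
    qed
    obtain w where w: "(\<rho> x ^^ m) {x, y} = {x, w}"
      using flagsE[OF tour_flags[of "k + m"]] seq[of m] m(1) by (metis order_refl prod.inject)
    have xw: "{x, w} \<in> T" "tour (k + m) = (x, {x, w})" using w m seq[of m] by auto
    then have "w \<in> Y" using edge_ends[of x w] tree_subset yx by blast
    have "next_edge \<rho> (remaining k) x {x, y} = {x, w}"
      using next_edge_eq[of m x "{x, y}" "remaining k"] m skip w tree_remaining[of k] by auto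
    then have nbr: "next_nbr \<rho> (remaining k) x y = w" by (simp add: next_nbr_def)
    have no_Y: "snd (tour i) \<in> T" if "k \<le> i" "i < Suc (k + m)" "fst (tour i) \<in> Y" for i
    proof -
      have "i = k" using seq[of "i - k"] that yx disjoint by (cases "i = k") auto
      then show ?thesis using k True by simp
    qed
    have rem: "remaining (k + m) = remaining k" "remaining (Suc (k + m)) = remaining k"
      using no_Y by (intro remaining_eq; simp)+
    show ?thesis
    proof (cases "k + m = len")
      \<comment> \<open>The round closes at \<open>x\<close>, so the tour began there. The next
        traversal would repeat that of the base edge, and the process halts.\<close>
      case True
      then have tour0: "tour 0 = (x, {x, w})" using xw tour_len tour_0 by metis
      then have "k \<noteq> 0" using k \<open>x \<noteq> y\<close> by (metis prod.inject)
      with tour0 xw have "(x, w) \<in> traversed k" unfolding traversed_def by blast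
      moreover have "remaining k = T" using rem(1) True remaining_len by simp
      ultimately show ?thesis using run_halted[of f "(remaining k, y, x, traversed k)"] keep nbr by simp
    next
      case False
      then have less: "k + m < len" using \<open>k + m \<le> len\<close> by simp
      have "(x, w) \<notin> traversed k"
      proof -
        have "tour i \<noteq> (x, {x, w})" if "i < k" for i
          using tour_eqD[of i "k + m"] xw less that by auto
        then show ?thesis by (auto simp: traversed_def)
      qed
      have trav: "traversed (Suc (k + m)) = insert (x, w) (insert (y, x) (traversed k))" (is "?l = ?r")
      proof
        show "?l \<subseteq> ?r"
        proof (rule subrelI, rule ccontr)
          fix a b assume ab: "(a, b) \<in> traversed (Suc (k + m))" "(a, b) \<notin> ?r"
          then obtain i where i: "{a, b} \<in> T" "i \<le> k + m" "tour i = (a, {a, b})" "k \<le> i"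
            by (auto simp: traversed_def less_Suc_eq_le not_less[symmetric])
          have "\<not> (k < i \<and> i < k + m)"
          proof
            assume ik: "k < i \<and> i < k + m"
            then have "0 < i - k" "i - k < m" "k + (i - k) = i" by auto
            with seq[of "i - k"] least[of "i - k"] i show False by auto
          qed
          then have "i = k \<or> i = k + m" using i by linarith
          then show False using i k xw ab(2) by (auto simp: doubleton_eq_iff)
        qed
        show "?r \<subseteq> ?l"
        proof -
          have "k < Suc (k + m)" "k + m < Suc (k + m)" "\<And>i. i < k \<Longrightarrow> i < Suc (k + m)" by auto
          then show ?thesis unfolding traversed_def using k xw True by blast
        qed
      qed
      have wx: "{w, x} \<in> T" using xw by (simp add: insert_commute)
      have next_flag: "tour (Suc (k + m)) = (w, \<rho> w {w, x})"
        using xw by (simp add: tour_Suc insert_commute)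
      define z where "z = next_nbr \<rho> (remaining k) w x"
      have step: "run f (remaining k, y, x, traversed k)
          = run f (remaining k, w, z, traversed (Suc (k + m)))"
        by (rule run_step) (use keep fresh \<open>(x, w) \<notin> _\<close> nbr trav in \<open>auto simp: z_def\<close>)
      show ?thesis
      proof (cases "Suc (k + m) = len")
        \<comment> \<open>The round closes after the traversal from \<open>x\<close> to
          \<open>w\<close>. Only \<open>T\<close> remains, so the next current edge is a tree edge
          already traversed from \<open>w\<close>, and the process halts one step later.\<close>
        case True
        have rT: "remaining k = T" using rem(2) True remaining_len by simp
        have inc: "{w, x} \<in> incident_edges G w" using wx tree_subset by (auto simp: incident_edges_def)
        have "w \<in> N" using \<open>w \<in> Y\<close> N_eq by auto
        let ?Q = "\<lambda>m. 0 < m \<and> (\<rho> w ^^ m) {w, x} \<in> T"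
        have "\<exists>m. ?Q m" using ex_funpow_rho[OF \<open>w \<in> N\<close> inc inc] wx by metis
        from LeastI_ex[OF this] have nT: "next_edge \<rho> T w {w, x} \<in> T" by (simp add: next_edge_def)
        have "(w, (\<rho> w ^^ n) {w, x}) \<in> flags" for n
          by (induction n) (use inc \<open>w \<in> N\<close> permutes_in_image[OF rho_permutes] in \<open>auto simp: flags_iff\<close>)
        then have "w \<in> next_edge \<rho> T w {w, x}" by (simp add: next_edge_def flags_def)
        with nT obtain z' where "next_edge \<rho> T w {w, x} = {w, z'}"
          using T.edges[of "next_edge \<rho> T w {w, x}"] by (metis insertE insert_commute singletonD)
        then have z: "next_edge \<rho> T w {w, x} = {w, z}"
          unfolding z_def next_nbr_def rT by simp
        then have wz: "{w, z} \<in> T" using nT by simp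
        then have "(w, {w, z}) \<in> flags" using tree_subset by (auto simp: flags_def)
        then obtain i where "i < len" "tour i = (w, {w, z})" by (rule flag_index)
        then have "(w, z) \<in> traversed (Suc (k + m))" using wz True by (auto simp: traversed_def)
        then show ?thesis
          unfolding step unfolding rT
          using run_halted[of f "(T, w, z, traversed (Suc (k + m)))"] tree_not_hypertree[OF wz] by simp
      next
        case False
        then have Suc: "Suc (k + m) < len" using less by linarith
        obtain x' where x': "x' \<in> X" "tour (Suc (k + m)) = (w, {w, x'})"
          "next_nbr \<rho> (remaining k) w x = x'"
          using next_nbr_fresh[OF next_flag \<open>w \<in> Y\<close> Suc, of k] by auto
        have "len - Suc (k + m) < len - k" using k by linarith
        from less.hyps[OF this Suc x'(2) \<open>w \<in> Y\<close> x'(1)] show ?thesis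
          unfolding step z_def x'(3) rem(2) .
      qed
    qed
  qed
qed

text \<open>A start in \<open>Y\<close> is index 0 of the tour. A start in \<open>X\<close> is index
  1: the base edge lies in \<open>T\<close>, and crossing it is the traversal recorded in the
  initial state.\<close>

lemma bernardi_outcome_eq:
  assumes deg: "\<forall>x\<in>X. degree T x = f x + 1" and s: "s = (b0, {b0, b1})"
  shows "bernardi_outcome N G X Y \<rho> b0 b1 f = Some T"
proof -
  have b: "{b0, b1} \<in> G" using start s by (auto simp: flags_def)
  have "\<exists>r. run f (bernardi_init Y \<rho> b0 b1 G) = Some (T, r)"
  proof (cases "b0 \<in> Y")
    case True
    have "tour 0 = (b0, {b0, b1})" using tour_0 s by (rule trans)
    moreover have "b1 \<in> X" using True edge_ends[OF b] by simp
    ultimately have "\<exists>r. run f (remaining 0, b0, b1, traversed 0) = Some (T, r)"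
      using run_tour[OF deg len_pos] True by blast
    moreover have "remaining 0 = G" "traversed 0 = {}" by (auto simp: remaining_def traversed_def)
    ultimately show ?thesis using True by simp
  next
    case False
    then have b': "b0 \<in> X" "b1 \<in> Y" using edge_ends[OF b] edge_nodes[OF b] N_eq by auto
    have tour0: "tour 0 = (b0, {b0, b1})" using tour_0 s by (rule trans)
    have T: "{b0, b1} \<in> T" using start_edge_in_tree s b' by (metis fst_conv snd_conv)
    have tour1: "tour 1 = (b1, \<rho> b1 {b1, b0})"
      using T tour_Suc[of 0] unfolding tour0 by (simp add: insert_commute)
    have "b0 \<noteq> b1" using T.edge_neq[OF T] .
    then have "len \<noteq> 1" using tour1 s tour_len by (metis prod.inject)
    then have len: "1 < len" using len_pos by linarith
    have rem: "remaining 0 = G" by (simp add: remaining_def)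
    obtain x' where x': "x' \<in> X" "tour 1 = (b1, {b1, x'})" "next_nbr \<rho> G b1 b0 = x'"
      using next_nbr_fresh[OF tour1 b'(2) len, of 0] rem by auto
    have "remaining 1 = G" "traversed 1 = {(b0, b1)}"
      using tour0 b' disjoint T unfolding remaining_def traversed_def
      by (auto simp: doubleton_eq_iff simp del: tour_0)
    then show ?thesis using run_tour[OF deg len x'(2) b'(2) x'(1)] False x'(3) by simp
  qed
  then show ?thesis by (auto simp: bernardi_outcome_def)
qed

text \<open>This makes the subtraction in \<open>tree_vector\<close> exact.\<close>

lemma degree_pos:
  assumes "x \<in> N"
  shows "0 < degree T x"
proof -
  obtain a b where "a \<in> N" "b \<in> N" "a \<noteq> b" using start edge_nodes edge_neq by (metis flagsE)
  then obtain y where "y \<in> N" "y \<noteq> x" by metis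
  with first_edge_towards[OF assms] obtain z where "{x, z} \<in> T" by metis
  then show ?thesis
    using T.finite_edges by (auto simp: degree_def card_gt_0_iff incident_edges_def)
qed

end

text \<open>One tree governs both runs: it is a Jaeger tree for the given structure and, with the
  classes exchanged, for the reversed one, and it realizes its own
  \<open>tree_vector\<close>.\<close>

lemma (in bipartite_ribbon) bernardi_outcome_reversed:
  assumes "{b0, b1} \<in> G" "hypertree_on N X G f"
  shows "\<exists>T. bernardi_outcome N G X Y \<rho> b0 b1 f = Some T \<and> spanning_tree N G T
    \<and> bernardi_outcome N G Y X (reversed \<rho>) b0 (opposite b0 (inv (\<rho> b0) {b0, b1})) (tree_vector T)
      = Some T"
proof -
  have s: "(b0, {b0, b1}) \<in> flags" using assms(1) by (simp add: flags_def)
  from ex_jaeger_tour[OF s assms(2)] obtain T where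
    T: "jaeger_tour N X Y G \<rho> T (b0, {b0, b1})" "\<forall>x\<in>X. degree T x = f x + 1" by blast
  interpret jaeger_tour N X Y G \<rho> T "(b0, {b0, b1})" by (rule T)
  interpret R: jaeger_tour N Y X G "reversed \<rho>" T "(b0, inv (\<rho> b0) {b0, b1})"
    using jaeger_tour_reversed by simp
  obtain b where b: "inv (\<rho> b0) {b0, b1} = {b0, b}"
    using R.flagsE[OF R.start] by (metis prod.inject)
  have "\<forall>y\<in>Y. degree T y = tree_vector T y + 1"
    using degree_pos N_eq by (fastforce simp: tree_vector_def)
  from R.bernardi_outcome_eq[OF this, of b0 b] b
  have "bernardi_outcome N G Y X (reversed \<rho>) b0 b (tree_vector T) = Some T" by simp
  then show ?thesis
    using bernardi_outcome_eq[OF T(2) refl] spanning_tree_T b by auto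
qed

section \<open>The bipartite graph of a hypergraph\<close>

lemma finite_emerald:
  assumes "finite V" "\<forall>A \<in># E. A \<subseteq> V"
  shows "finite (emerald E)"
proof (rule finite_subset)
  show "emerald E \<subseteq> Inr ` (SIGMA A:set_mset E. {..<count E A})"
    by (auto simp: emerald_def intro!: image_eqI count_inI)
qed auto

theorem theorem6p21:
  fixes V :: "'v set" and E :: "'v set multiset"
    and \<rho> :: "'v node \<Rightarrow> 'v node set \<Rightarrow> 'v node set"
    and b0 b1 :: "'v node" and f :: "'v node \<Rightarrow> nat"
  assumes "connected_hypergraph V E"
    and "ribbon_structure (bip_nodes V E) (bip_edges V E) \<rho>"
    and "{b0, b1} \<in> bip_edges V E"
    and "hypertree_on (bip_nodes V E) (emerald E) (bip_edges V E) f"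
  shows "\<exists>T. bernardi_outcome (bip_nodes V E) (bip_edges V E) (emerald E) (violet V)
               \<rho> b0 b1 f = Some T
           \<and> spanning_tree (bip_nodes V E) (bip_edges V E) T
           \<and> bernardi_outcome (bip_nodes V E) (bip_edges V E) (violet V) (emerald E)
               (reversed \<rho>) b0 (opposite b0 (inv (\<rho> b0) {b0, b1})) (tree_vector T) = Some T"
proof -
  have "finite V" "\<forall>A \<in># E. A \<subseteq> V"
    using assms(1) by (auto simp: connected_hypergraph_def hypergraph_def)
  then have fin: "finite (bip_nodes V E)"
    using finite_emerald[of V E] by (simp add: bip_nodes_def violet_def)
  \<comment> \<open>The emerald nodes take the role of \<open>X\<close>, the violet ones that of
    \<open>Y\<close>.\<close>
  interpret bipartite_ribbon "bip_nodes V E" "emerald E" "violet V" "bip_edges V E" \<rho>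
  proof
    show "finite (bip_nodes V E)" by (rule fin)
    show "bip_nodes V E = emerald E \<union> violet V" by (auto simp: bip_nodes_def)
    show "emerald E \<inter> violet V = {}" by (auto simp: emerald_def violet_def)
    show "\<exists>x\<in>emerald E. \<exists>y\<in>violet V. \<epsilon> = {x, y}" if "\<epsilon> \<in> bip_edges V E" for \<epsilon>
      using that by (fastforce simp: bip_edges_def emerald_def violet_def insert_commute)
  qed (rule assms(2))
  show ?thesis by (rule bernardi_outcome_reversed[OF assms(3,4)])
qed

end
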